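(* Let $n \geq 4$ be an integer and $p = \frac{n!\,(n-1)\,n}{2}$. Then the homology of the neighborhood complex of the exponential graph $K_{n+1}^{K_n}$ with $\mathbb{Z}_2$ coefficients is $$H_k(\mathcal{N}(K_{n+1}^{K_n}); \mathbb{Z}_2) \cong \begin{cases} \mathbb{Z}_2 & \text{if } k = 0,\ 1 \text{ or } n-1,\\ \mathbb{Z}_2^{\,p-n!+1} & \text{if } k = 2,\\ 0 & \text{otherwise.}\end{cases}$$
   Context: A graph $G$ is a pair $(V(G),E(G))$ with $E(G)\subset V(G)\times V(G)$ symmetric (undirected graph; loops are allowed); $x\sim y$ means $(x,y)\in E(G)$. $K_n$ is the complete graph on $[n]=\{1,\dots,n\}$, without loops. Exponential graph: for graphs $G,H$, $H^G$ is the graph whose vertices are all set maps $V(G)\to V(H)$, with $f\sim f'$ iff for all $v,v'\in V(G)$, $v\sim v'$ in $G$ implies $f(v)\sim f'(v')$ in $H$. Neighborhood complex: $\mathcal{N}(G)$ is the abstract simplicial complex whose simplices are the (finite, nonempty) subsets of $V(G)$ that have a common neighbor in $G$. $\mathbb{Z}_2=\mathbb{Z}/2\mathbb{Z}$, and $H_k$ is (unreduced) simplicial homology. *)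

theory Defs
  imports "HOL-Algebra.Product_Groups" "HOL-Algebra.Elementary_Groups"
begin

text \<open>A graph is a pair of a vertex set and a symmetric edge relation on it; loops are allowed.\<close>

type_synonym 'a graph = "'a set \<times> ('a \<times> 'a) set"

abbreviation verts :: "'a graph \<Rightarrow> 'a set" where "verts G \<equiv> fst G"

abbreviation edges :: "'a graph \<Rightarrow> ('a \<times> 'a) set" where "edges G \<equiv> snd G"

definition is_graph :: "'a graph \<Rightarrow> bool" where
  "is_graph G \<longleftrightarrow> edges G \<subseteq> verts G \<times> verts G \<and> sym (edges G)"

definition complete_graph :: "nat \<Rightarrow> nat graph" where
  "complete_graph n = ({1..n}, {(i, j). i \<in> {1..n} \<and> j \<in> {1..n} \<and> i \<noteq> j})"

text \<open>
  \<open>exponential_graph G H\<close> is $H^G$. Set maps from \<open>verts G\<close> to \<open>verts H\<close> are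
  represented by extensional functions, so that each map occurs exactly once.
\<close>

definition exponential_graph :: "'a graph \<Rightarrow> 'b graph \<Rightarrow> ('a \<Rightarrow> 'b) graph" where
  "exponential_graph G H =
     (verts G \<rightarrow>\<^sub>E verts H,
      {(f, f'). f \<in> verts G \<rightarrow>\<^sub>E verts H \<and> f' \<in> verts G \<rightarrow>\<^sub>E verts H \<and>
                (\<forall>v\<in>verts G. \<forall>v'\<in>verts G. (v, v') \<in> edges G \<longrightarrow> (f v, f' v') \<in> edges H)})"

lemma is_graph_complete_graph: "is_graph (complete_graph n)"
  by (auto simp: is_graph_def complete_graph_def sym_def)

lemma is_graph_exponential_graph:
  assumes "is_graph G" "is_graph H"
  shows "is_graph (exponential_graph G H)"
  using assms unfolding is_graph_def exponential_graph_def sym_def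
  by (simp add: subset_iff)

text \<open>
  An abstract simplicial complex is represented by its set of simplices, which are
  nonempty finite sets.
\<close>

definition neighborhood_complex :: "'a graph \<Rightarrow> 'a set set" where
  "neighborhood_complex G =
     {\<sigma>. \<sigma> \<subseteq> verts G \<and> finite \<sigma> \<and> \<sigma> \<noteq> {} \<and> (\<exists>w\<in>verts G. \<forall>v\<in>\<sigma>. (v, w) \<in> edges G)}"

text \<open>
  The dimension is an integer. Since the empty set is never a simplex, there are no
  simplices of negative dimension, so the chain groups vanish there and the homology below
  is unreduced.
\<close>

definition simplices :: "int \<Rightarrow> 'a set set \<Rightarrow> 'a set set" where
  "simplices k K = {\<sigma> \<in> K. finite \<sigma> \<and> \<sigma> \<noteq> {} \<and> int (card \<sigma>) = k + 1}"

abbreviation Z2 :: "int monoid" where "Z2 \<equiv> integer_mod_group 2"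

definition Z2_power :: "nat \<Rightarrow> (nat \<Rightarrow> int) monoid" where
  "Z2_power m = product_group {..<m} (\<lambda>_. Z2)"

definition simplicial_chain_group :: "int \<Rightarrow> 'a set set \<Rightarrow> ('a set \<Rightarrow> int) monoid" where
  "simplicial_chain_group k K = sum_group (simplices k K) (\<lambda>_. Z2)"

text \<open>
  The boundary of a simplex is the sum of its codimension-one faces; modulo 2 no orientations
  are needed. Hence the coefficient of \<open>\<tau>\<close> in the boundary of a chain \<open>c\<close> is the sum of the
  coefficients of \<open>c\<close> at the simplices having \<open>\<tau>\<close> as a codimension-one face. The sum is
  restricted to the support of \<open>c\<close>, which is finite even if \<open>K\<close> is not locally finite.
\<close>

definition simplicial_boundary ::
    "int \<Rightarrow> 'a set set \<Rightarrow> ('a set \<Rightarrow> int) \<Rightarrow> ('a set \<Rightarrow> int)" where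
  "simplicial_boundary k K c =
     (\<lambda>\<tau>\<in>simplices (k - 1) K.
        (\<Sum>\<sigma> | \<sigma> \<in> simplices k K \<and> c \<sigma> \<noteq> 0 \<and> \<tau> \<subseteq> \<sigma>. c \<sigma>) mod 2)"

definition simplicial_cycles :: "int \<Rightarrow> 'a set set \<Rightarrow> ('a set \<Rightarrow> int) set" where
  "simplicial_cycles k K =
     kernel (simplicial_chain_group k K) (simplicial_chain_group (k - 1) K)
       (simplicial_boundary k K)"

definition simplicial_boundaries :: "int \<Rightarrow> 'a set set \<Rightarrow> ('a set \<Rightarrow> int) set" where
  "simplicial_boundaries k K =
     simplicial_boundary (k + 1) K ` carrier (simplicial_chain_group (k + 1) K)"

definition simplicial_homology :: "int \<Rightarrow> 'a set set \<Rightarrow> ('a set \<Rightarrow> int) set monoid" where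
  "simplicial_homology k K =
     subgroup_generated (simplicial_chain_group k K) (simplicial_cycles k K)
       Mod simplicial_boundaries k K"

end

(*
  A simplex is a set of maps with a common neighbour g. If g repeats a colour c, no map of the
  simplex uses c, so the simplex misses a colour; if g is injective with missing colour c, the
  simplex lies in the product of the sets {g j, c}. The simplices missing a colour form a
  subcomplex that collapses to the boundary of the simplex of constant maps, a sphere of
  dimension n - 1. In the relative complex, adding or removing the constant map c cancels
  everything except the edges {g, c}, the edges {g, g'} with g' obtained from g by recolouring one
  point with c, and the triangles {g, g', c}. The boundary of such a triangle is the sum of two of
  these edges, so what remains is the incidence structure of a graph, and the graph is connected.
  All connecting homomorphisms vanish, and counting gives the Betti numbers.
*)
theory Submission
  imports Defs "HOL-Library.Z2" "HOL-Library.Function_Algebras"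
begin

section \<open>Mod 2 homology of finite families of cells\<close>

text \<open>All chain groups are finite, and an elementary abelian 2-group is determined by its
  order. So homology is handled by counting cycles and boundaries: exact sequences become products
  of orders.

  The obstacle to the cancellation is that the constant map to toggle depends on g. A simplex using
  all colours determines g unless it is an edge {g, g'} between two injections that differ at one
  point. Such an edge could be matched with two triangles, one for each missing colour, so the edge
  and both triangles are kept. An edge {g, c} stays because removing c leaves {g}, which misses a
  colour.

  What remains is (n+1)! edges {g, c}, (n+1)! n/2 edges {g, g'} and (n+1)! n triangles. As the graph
  is connected, its cycle rank is (n+1)! n - (n+1)! n/2 - (n+1)! + 1, which is p - n! + 1. The
  sphere has dimension n - 1, so a connecting homomorphism could only be nonzero from dimension n,
  above the dimensions 1 and 2 of the remaining cells; and n \<ge> 4 keeps n - 1 apart from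
  2.\<close>

definition cofaces :: "'a set set \<Rightarrow> 'a set \<Rightarrow> 'a set set" where
  "cofaces X t = {s \<in> X. t \<subset> s \<and> card s = Suc (card t)}"

definition bd :: "'a set set \<Rightarrow> ('a set \<Rightarrow> bit) \<Rightarrow> 'a set \<Rightarrow> bit" where
  "bd X c t = (if t \<in> X then \<Sum>s\<in>cofaces X t. c s else 0)"

text \<open>
  Cells are graded by cardinality, so degree \<open>d\<close> here is dimension \<open>d - 1\<close>. A family that is not
  closed under subsets yields relative chains, and a complex together with the cell \<open>{}\<close> yields
  reduced homology.
\<close>
definition cell_chains :: "'a set set \<Rightarrow> nat \<Rightarrow> ('a set \<Rightarrow> bit) set" where
  "cell_chains X d = {c. \<forall>s. c s \<noteq> 0 \<longrightarrow> s \<in> X \<and> card s = d}"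

definition cycles :: "'a set set \<Rightarrow> nat \<Rightarrow> ('a set \<Rightarrow> bit) set" where
  "cycles X d = {c \<in> cell_chains X d. bd X c = 0}"

definition boundaries :: "'a set set \<Rightarrow> nat \<Rightarrow> ('a set \<Rightarrow> bit) set" where
  "boundaries X d = bd X ` cell_chains X (Suc d)"

text \<open>Orders replace dimensions: cycles modulo boundaries have \<open>2 ^ m\<close> elements.
  Being a relation, it requires no logarithm.\<close>

definition betti :: "'a set set \<Rightarrow> nat \<Rightarrow> nat \<Rightarrow> bool" where
  "betti X d m \<longleftrightarrow> card (cycles X d) = 2 ^ m * card (boundaries X d)"

text \<open>Besides complexes this covers the difference of a complex and a subcomplex, which
  carries the relative chains. Closure between two members is what makes \<open>bd X\<close> square
  to zero.\<close>

definition convex_cells :: "'a set set \<Rightarrow> bool" where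
  "convex_cells X \<longleftrightarrow> finite X \<and> (\<forall>s\<in>X. finite s) \<and>
     (\<forall>t\<in>X. \<forall>u\<in>X. \<forall>s. t \<subseteq> s \<and> s \<subseteq> u \<longrightarrow> s \<in> X)"

definition lower_set :: "'a set set \<Rightarrow> 'a set set \<Rightarrow> bool" where
  "lower_set L X \<longleftrightarrow> L \<subseteq> X \<and> (\<forall>s\<in>L. \<forall>t\<in>X. t \<subseteq> s \<longrightarrow> t \<in> L)"

lemma bit_fun_add_self [simp]: "c + c = (0 :: 'a \<Rightarrow> bit)"
  by (rule ext) (metis bit_2_eq_0 mult_2 mult_zero_left plus_fun_apply zero_fun_apply)

lemma bit_fun_diff [simp]: "c - d = c + (d :: 'a \<Rightarrow> bit)"
  by (rule ext) simp

lemma convex_cellsD: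
  assumes "convex_cells X"
  shows "finite X" "s \<in> X \<Longrightarrow> finite s" "t \<in> X \<Longrightarrow> u \<in> X \<Longrightarrow> t \<subseteq> s \<Longrightarrow> s \<subseteq> u \<Longrightarrow> s \<in> X"
  using assms unfolding convex_cells_def by blast+

lemma lower_setD:
  assumes "lower_set L X"
  shows "L \<subseteq> X" "s \<in> L \<Longrightarrow> t \<in> X \<Longrightarrow> t \<subseteq> s \<Longrightarrow> t \<in> L"
  using assms unfolding lower_set_def by blast+

lemma convex_cells_lower_set:
  assumes "convex_cells X" "lower_set L X"
  shows "convex_cells L"
  using assms unfolding convex_cells_def lower_set_def by (meson finite_subset subsetD)

lemma convex_cells_Diff:
  assumes "convex_cells X" "lower_set L X"
  shows "convex_cells (X - L)"
  using assms unfolding convex_cells_def lower_set_def by (metis DiffE DiffI finite_Diff)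

lemma finite_cofaces: "finite X \<Longrightarrow> finite (cofaces X t)"
  by (simp add: cofaces_def)

lemma bd_add: "bd X (c + d) = bd X c + bd X d"
  unfolding bd_def fun_eq_iff plus_fun_apply by (auto simp only: sum.distrib add_0_right split: if_splits)

lemma bd_0 [simp]: "bd X 0 = 0"
  by (rule ext) (simp add: bd_def)

lemma cell_chains_add: "c \<in> cell_chains X d \<Longrightarrow> c' \<in> cell_chains X d \<Longrightarrow> c + c' \<in> cell_chains X d"
  unfolding cell_chains_def plus_fun_def mem_Collect_eq by (metis add.right_neutral)

lemma zero_in_cell_chains [simp]: "0 \<in> cell_chains X d"
  by (simp add: cell_chains_def)

lemma bd_in_cell_chains:
  assumes "c \<in> cell_chains X (Suc d)"
  shows "bd X c \<in> cell_chains X d"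
proof -
  have "card t = d" "t \<in> X" if "bd X c t \<noteq> 0" for t
  proof -
    from that have "(\<Sum>s\<in>cofaces X t. c s) \<noteq> 0" and "t \<in> X"
      by (auto simp: bd_def split: if_splits)
    then obtain s where "s \<in> cofaces X t" "c s \<noteq> 0"
      by (meson sum.neutral)
    then show "card t = d" "t \<in> X"
      using assms \<open>t \<in> X\<close> by (auto simp: cell_chains_def cofaces_def)
  qed
  then show ?thesis
    by (auto simp: cell_chains_def)
qed

lemma bd_cell_chains_0: "c \<in> cell_chains X 0 \<Longrightarrow> bd X c = 0"
  by (rule ext) (force simp: bd_def cell_chains_def cofaces_def intro!: sum.neutral)

text \<open>The difference \<open>u - t\<close> has two elements, and an intermediate set adds one
  of them to \<open>t\<close>. The bulky set matches the range of summation in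
  \<open>bd_bd\<close>.\<close>

lemma between_two:
  assumes "t \<subset> s" "s \<subset> u" "finite u" "card s = Suc (card t)" "card u = Suc (card s)"
  shows "card {r. t \<subset> r \<and> card r = Suc (card t) \<and> r \<subset> u \<and> card u = Suc (card r)} = 2"
    (is "card ?M = 2")
proof -
  have fin: "finite t"
    using assms finite_subset psubset_imp_subset by metis
  have card_Diff: "card (u - t) = 2"
    using assms fin by (subst card_Diff_subset) auto
  have "?M = (\<lambda>x. insert x t) ` (u - t)"
  proof (intro equalityI subsetI)
    fix r assume r: "r \<in> ?M"
    then have "card (r - t) = 1"
      using fin by (simp add: card_Diff_subset psubset_imp_subset)
    then obtain x where "r - t = {x}"
      by (metis card_1_singletonE)
    then have "r = insert x t" "x \<in> r" "x \<notin> t"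
      using r by blast+
    then show "r \<in> (\<lambda>x. insert x t) ` (u - t)"
      using r by blast
  next
    fix r assume "r \<in> (\<lambda>x. insert x t) ` (u - t)"
    then obtain x where x: "x \<in> u" "x \<notin> t" "r = insert x t"
      by blast
    then have "card r = Suc (card t)"
      using fin by simp
    moreover have "r \<subset> u"
      using x assms calculation by auto
    ultimately show "r \<in> ?M"
      using x assms by auto
  qed
  moreover have "inj_on (\<lambda>x. insert x t) (u - t)"
    by (rule inj_onI) blast
  ultimately show ?thesis
    using card_Diff by (simp add: card_image)
qed

text \<open>After the sums are swapped, each \<open>u\<close> contributes \<open>c u\<close> once
  for every cell between \<open>t\<close> and \<open>u\<close>. There are none or two of these,
  since convexity puts both intermediate sets into \<open>X\<close>.\<close>

lemma bd_bd:
  assumes X: "convex_cells X"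
  shows "bd X (bd X c) = 0"
proof
  fix t
  show "bd X (bd X c) t = 0 t"
  proof (cases "t \<in> X")
    case True
    have fin: "finite X"
      using X by (rule convex_cellsD)
    have "bd X (bd X c) t = (\<Sum>s\<in>cofaces X t. \<Sum>u\<in>{u \<in> X. s \<subset> u \<and> card u = Suc (card s)}. c u)"
      using True by (simp add: bd_def cofaces_def)
    also have "\<dots> = (\<Sum>u\<in>X. \<Sum>s\<in>{s \<in> cofaces X t. s \<subset> u \<and> card u = Suc (card s)}. c u)"
      using fin by (intro sum.swap_restrict finite_cofaces)
    also have "\<dots> = 0"
    proof (rule sum.neutral, rule ballI)
      fix u assume u: "u \<in> X"
      let ?M = "{s \<in> cofaces X t. s \<subset> u \<and> card u = Suc (card s)}"
      have eq: "?M = {r. t \<subset> r \<and> card r = Suc (card t) \<and> r \<subset> u \<and> card u = Suc (card r)}"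
        using convex_cellsD(3)[OF X True u] by (auto simp: cofaces_def)
      show "(\<Sum>s\<in>?M. c u) = 0"
      proof (cases "?M = {}")
        case False
        then obtain s where "s \<in> ?M"
          by blast
        then have "card ?M = 2"
          unfolding eq using between_two[of t s u] convex_cellsD(2)[OF X u]
          by (auto simp: cofaces_def)
        then show ?thesis
          by (simp only: sum_constant of_nat_numeral bit_2_eq_0 mult_zero_left)
      qed (simp only: sum.empty)
    qed
    finally show ?thesis
      by simp
  qed (simp add: bd_def)
qed

lemma boundaries_subset_cycles:
  assumes "convex_cells X"
  shows "boundaries X d \<subseteq> cycles X d"
  using assms by (auto simp: boundaries_def cycles_def bd_bd bd_in_cell_chains)

lemma card_cell_chains:
  assumes "finite X"
  shows "finite (cell_chains X d)" and "card (cell_chains X d) = 2 ^ card {s \<in> X. card s = d}"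
proof -
  let ?S = "{s \<in> X. card s = d}"
  have bij: "bij_betw (\<lambda>A s. if s \<in> A then 1 else 0) (Pow ?S) (cell_chains X d)"
    by (rule bij_betw_byWitness[where f' = "\<lambda>c. {s. c s \<noteq> 0}"])
      (auto simp: cell_chains_def fun_eq_iff split: if_splits)
  show "finite (cell_chains X d)"
    using bij_betw_finite[OF bij] assms by simp
  show "card (cell_chains X d) = 2 ^ card ?S"
    using bij_betw_same_card[OF bij] assms by (simp add: card_Pow)
qed

lemma finite_cycles: "finite X \<Longrightarrow> finite (cycles X d)"
  unfolding cycles_def by (simp add: card_cell_chains(1))

lemma finite_boundaries: "finite X \<Longrightarrow> finite (boundaries X d)"
  unfolding boundaries_def by (simp add: card_cell_chains(1))

lemma zero_in_cycles: "0 \<in> cycles X d"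
  by (simp add: cycles_def)

lemma zero_in_boundaries: "0 \<in> boundaries X d"
  unfolding boundaries_def by (metis bd_0 image_eqI zero_in_cell_chains)

lemma cycles_add: "c \<in> cycles X d \<Longrightarrow> c' \<in> cycles X d \<Longrightarrow> c + c' \<in> cycles X d"
  by (simp add: cycles_def cell_chains_add bd_add)

lemma boundaries_add:
  "c \<in> boundaries X d \<Longrightarrow> c' \<in> boundaries X d \<Longrightarrow> c + c' \<in> boundaries X d"
  unfolding boundaries_def by (auto simp: image_iff) (metis bd_add cell_chains_add)

text \<open>All fibres over the image are translates of the kernel: the first isomorphism theorem in
  terms of orders.\<close>

lemma card_kernel_times_image:
  fixes f :: "'a::ab_group_add \<Rightarrow> 'b::ab_group_add"
  assumes "finite A" and diff: "\<And>x y. x \<in> A \<Longrightarrow> y \<in> A \<Longrightarrow> x - y \<in> A"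
    and f: "\<And>x y. x \<in> A \<Longrightarrow> y \<in> A \<Longrightarrow> f (x - y) = f x - f y"
  shows "card A = card {x \<in> A. f x = 0} * card (f ` A)"
proof -
  have fiber: "card {x \<in> A. f x = y} = card {x \<in> A. f x = 0}" if "y \<in> f ` A" for y
  proof -
    obtain a where a: "a \<in> A" "y = f a"
      using \<open>y \<in> f ` A\<close> by blast
    have "a - a \<in> A"
      using a diff by blast
    then have 0: "0 \<in> A"
      by simp
    then have minus: "- x \<in> A" if "x \<in> A" for x
      using that diff[of 0 x] by simp
    have add: "x + a \<in> A" if "x \<in> A" for x
      using that diff[of x "- a"] minus[of a] a by simp
    have "bij_betw (\<lambda>x. x - a) {x \<in> A. f x = y} {x \<in> A. f x = 0}"
    proof (rule bij_betw_byWitness[where f' = "\<lambda>x. x + a"])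
      show "(\<lambda>x. x + a) ` {x \<in> A. f x = 0} \<subseteq> {x \<in> A. f x = y}"
        using add a f by auto (metis add add_diff_cancel diff_eq_eq f add_0)
    qed (use a diff f in auto)
    then show ?thesis
      by (rule bij_betw_same_card)
  qed
  have "card A = (\<Sum>y\<in>f ` A. card {x \<in> A. f x = y})"
    using sum.image_gen[OF assms(1), of "\<lambda>_. 1 :: nat" f] by simp
  also have "\<dots> = card {x \<in> A. f x = 0} * card (f ` A)"
    by (simp add: fiber)
  finally show ?thesis .
qed

text \<open>Rank-nullity for the boundary map, in multiplicative form.\<close>

lemma card_cycles_times_boundaries:
  assumes "finite X"
  shows "card (cell_chains X (Suc d)) = card (cycles X (Suc d)) * card (boundaries X d)"
  unfolding cycles_def boundaries_def
  by (rule card_kernel_times_image) (use assms in \<open>auto simp: card_cell_chains cell_chains_add bd_add\<close>)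

lemma betti_0_iff:
  assumes "convex_cells X"
  shows "betti X d 0 \<longleftrightarrow> cycles X d = boundaries X d"
  unfolding betti_def
  using assms finite_cycles boundaries_subset_cycles convex_cellsD(1) card_subset_eq
  by (metis mult_1 power_0)


section \<open>Exact sequence of a pair, by counting\<close>

lemma cell_chains_mono: "L \<subseteq> X \<Longrightarrow> cell_chains L d \<subseteq> cell_chains X d"
  by (auto simp: cell_chains_def)

lemma bd_lower:
  assumes "finite X" "lower_set L X" "c \<in> cell_chains L d"
  shows "bd X c = bd L c"
proof
  fix t
  show "bd X c t = bd L c t"
  proof (cases "t \<in> L")
    case True
    have "(\<Sum>s\<in>cofaces X t. c s) = (\<Sum>s\<in>cofaces L t. c s)"
      using assms by (intro sum.mono_neutral_right)
        (auto simp: cofaces_def cell_chains_def lower_set_def simp del: bit_not_zero_iff)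
    with True lower_setD(1)[OF assms(2)] show ?thesis
      by (auto simp only: bd_def)
  next
    case False
    have "(\<Sum>s\<in>cofaces X t. c s) = 0" if "t \<in> X"
    proof (rule sum.neutral, rule ballI)
      fix s assume "s \<in> cofaces X t"
      then have "s \<notin> L"
        using False that lower_setD(2)[OF assms(2)] by (auto simp: cofaces_def)
      then show "c s = 0"
        using assms(3) by (auto simp: cell_chains_def)
    qed
    with False show ?thesis
      by (simp add: bd_def)
  qed
qed

text \<open>For \<open>Y = X - L\<close> this is the projection onto relative chains.\<close>

definition restr :: "'a set set \<Rightarrow> ('a set \<Rightarrow> bit) \<Rightarrow> 'a set \<Rightarrow> bit" where
  "restr Y c s = (if s \<in> Y then c s else 0)"

lemma restr_add: "restr Y (c + d) = restr Y c + restr Y d"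
  by (rule ext) (simp add: restr_def)

lemma restr_in_cell_chains: "c \<in> cell_chains X d \<Longrightarrow> restr Y c \<in> cell_chains Y d"
  by (simp add: cell_chains_def restr_def)

lemma restr_ident: "c \<in> cell_chains Y d \<Longrightarrow> restr Y c = c"
  by (rule ext) (auto simp: cell_chains_def restr_def)

lemma restr_eq_0_iff:
  assumes "c \<in> cell_chains X d"
  shows "restr (X - L) c = 0 \<longleftrightarrow> c \<in> cell_chains L d"
  using assms by (auto simp: cell_chains_def restr_def fun_eq_iff)

lemma restr_bd:
  assumes "lower_set L X" "c \<in> cell_chains X d" "finite X"
  shows "restr (X - L) (bd X c) = bd (X - L) (restr (X - L) c)"
proof
  fix t
  show "restr (X - L) (bd X c) t = bd (X - L) (restr (X - L) c) t"
  proof (cases "t \<in> X - L")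
    case True
    then have "cofaces X t = cofaces (X - L) t"
      using lower_setD(2)[OF assms(1)] by (auto simp: cofaces_def)
    moreover have "(\<Sum>s\<in>cofaces (X - L) t. c s) = (\<Sum>s\<in>cofaces (X - L) t. restr (X - L) c s)"
      by (rule sum.cong) (auto simp: cofaces_def restr_def)
    moreover have "t \<in> X"
      using True by blast
    ultimately show ?thesis
      using True unfolding restr_def[of _ "bd X c"] bd_def by (simp only: if_True)
  next
    case False
    then show ?thesis
      by (auto simp: restr_def bd_def simp del: bit_not_zero_iff)
  qed
qed

text \<open>Each of the last two alternatives in \<open>exact\<close> kills the connecting
  homomorphism, because its source or its target vanishes; a relative cycle then lifts to an
  absolute one. In degree 0 there is nothing below.\<close>

lemma restr_cycles_surj:
  assumes X: "convex_cells X" and L: "lower_set L X"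
    and exact: "d = 0 \<or> cycles (X - L) d = boundaries (X - L) d
      \<or> cycles L (d - 1) = boundaries L (d - 1)"
  shows "restr (X - L) ` cycles X d = cycles (X - L) d"
proof (intro equalityI subsetI)
  let ?Y = "X - L"
  have fin: "finite X"
    using X by (rule convex_cellsD)
  fix c assume c: "c \<in> cycles ?Y d"
  then have cX: "c \<in> cell_chains X d" and cY: "c \<in> cell_chains ?Y d" and bdY: "bd ?Y c = 0"
    using cell_chains_mono[of ?Y X d] by (auto simp: cycles_def)
  consider "d = 0" | "c \<in> boundaries ?Y d" | e where "d = Suc e" "cycles L e = boundaries L e"
    using exact c by (cases d) auto
  then show "c \<in> restr ?Y ` cycles X d"
  proof cases
    case 1
    then have "c \<in> cycles X d"
      using cX bd_cell_chains_0 by (auto simp: cycles_def)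
    with restr_ident[OF cY] show ?thesis
      by (metis imageI)
  next
    case 2
    then obtain b where b: "b \<in> cell_chains ?Y (Suc d)" "c = bd ?Y b"
      by (auto simp: boundaries_def)
    then have bX: "b \<in> cell_chains X (Suc d)"
      using cell_chains_mono[of ?Y X] by auto
    \<comment> \<open>The relative chain \<open>b\<close> is also a chain of \<open>X\<close>; its
      boundary taken there is the lift.\<close>
    have "restr ?Y (bd X b) = c"
      using restr_bd[OF L bX fin] restr_ident[OF b(1)] b(2) by simp
    moreover have "bd X b \<in> cycles X d"
      using bX X by (simp add: cycles_def bd_bd bd_in_cell_chains)
    ultimately show ?thesis
      by blast
  next
    case 3
    have e: "bd X c \<in> cell_chains X e"
      using cX 3 bd_in_cell_chains by auto
    have "restr ?Y (bd X c) = 0"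
      using restr_bd[OF L cX fin] restr_ident[OF cY] bdY by simp
    then have eL: "bd X c \<in> cell_chains L e"
      using restr_eq_0_iff[OF e] by simp
    then have "bd X c \<in> cycles L e"
      using bd_lower[OF fin L eL] bd_bd[OF X] by (simp add: cycles_def)
    then obtain b where b: "b \<in> cell_chains L (Suc e)" "bd X c = bd L b"
      using 3 by (auto simp: boundaries_def)
    then have bX: "b \<in> cell_chains X d"
      using 3 cell_chains_mono[OF lower_setD(1)[OF L]] by auto
    \<comment> \<open>\<open>b\<close> fills the boundary of \<open>c\<close>, which lies in
      \<open>L\<close>; adding it yields an absolute cycle with the same projection.\<close>
    have "bd X (c + b) = 0"
      using b bd_lower[OF fin L b(1)] by (simp add: bd_add)
    then have "c + b \<in> cycles X d"
      using cX bX by (simp add: cycles_def cell_chains_add)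
    moreover have "restr ?Y b = 0"
      using restr_eq_0_iff[OF bX] b 3 by simp
    then have "restr ?Y (c + b) = c"
      using restr_ident[OF cY] by (simp add: restr_add)
    ultimately show ?thesis
      by (metis imageI)
  qed
next
  fix c assume "c \<in> restr (X - L) ` cycles X d"
  then obtain b where b: "b \<in> cell_chains X d" "bd X b = 0" "c = restr (X - L) b"
    by (auto simp: cycles_def)
  then have "bd (X - L) c = restr (X - L) 0"
    using restr_bd[OF L b(1) convex_cellsD(1)[OF X]] by simp
  also have "\<dots> = 0"
    by (rule ext) (simp add: restr_def)
  finally show "c \<in> cycles (X - L) d"
    using restr_in_cell_chains[OF b(1)] b(3) by (simp add: cycles_def)
qed

lemma card_cycles_lower:
  assumes X: "convex_cells X" and L: "lower_set L X"
    and exact: "d = 0 \<or> cycles (X - L) d = boundaries (X - L) d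
      \<or> cycles L (d - 1) = boundaries L (d - 1)"
  shows "card (cycles X d) = card (cycles L d) * card (cycles (X - L) d)"
proof -
  have fin: "finite X"
    using X by (rule convex_cellsD)
  have "{c \<in> cycles X d. restr (X - L) c = 0} = cycles L d"
    using restr_eq_0_iff[of _ X d L] bd_lower[OF fin L] cell_chains_mono[OF lower_setD(1)[OF L]]
    by (fastforce simp: cycles_def)
  then show ?thesis
    using card_kernel_times_image[of "cycles X d" "restr (X - L)"] restr_cycles_surj[OF assms]
    by (simp add: finite_cycles fin cycles_add restr_add)
qed

lemma card_cell_chains_lower:
  assumes X: "finite X" and L: "L \<subseteq> X"
  shows "card (cell_chains X d) = card (cell_chains L d) * card (cell_chains (X - L) d)"
proof -
  have "{s \<in> X. card s = d} = {s \<in> L. card s = d} \<union> {s \<in> X - L. card s = d}"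
    using L by auto
  moreover have "card ({s \<in> L. card s = d} \<union> {s \<in> X - L. card s = d})
      = card {s \<in> L. card s = d} + card {s \<in> X - L. card s = d}"
    using X finite_subset[OF L X] by (intro card_Un_disjoint) auto
  moreover have "finite L"
    using X L finite_subset by blast
  ultimately show ?thesis
    using X by (simp add: card_cell_chains power_add)
qed

text \<open>
  The hypothesis makes every connecting homomorphism of the pair vanish.
\<close>
lemma betti_lower:
  assumes X: "convex_cells X" and L: "lower_set L X"
    and exact: "\<And>d. cycles (X - L) (Suc d) = boundaries (X - L) (Suc d)
      \<or> cycles L d = boundaries L d"
    and "betti L d l" "betti (X - L) d m"
  shows "betti X d (l + m)"
proof -
  have fin: "finite X" "finite L"
    using convex_cellsD(1)[OF X] finite_subset[OF lower_setD(1)[OF L]] by simp_all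
  \<comment> \<open>For \<open>e = 0\<close> the truncated \<open>e - 1\<close> does no harm, since
    \<open>card_cycles_lower\<close> accepts degree 0 outright.\<close>
  have Z: "card (cycles X e) = card (cycles L e) * card (cycles (X - L) e)" for e
    using exact[of "e - 1"] by (intro card_cycles_lower X L) (cases e; auto)
  \<comment> \<open>Boundaries are not compared directly: the orders of chains and cycles multiply,
    hence by rank-nullity so do those of the boundaries one degree lower.\<close>
  have "card (cycles X (Suc d)) * card (boundaries X d)
      = (card (cycles L (Suc d)) * card (boundaries L d))
        * (card (cycles (X - L) (Suc d)) * card (boundaries (X - L) d))"
    using card_cell_chains_lower[OF fin(1) lower_setD(1)[OF L], of "Suc d"] fin
    by (simp add: card_cycles_times_boundaries)
  moreover have "card (cycles X (Suc d)) \<noteq> 0"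
    using fin zero_in_cycles finite_cycles card_0_eq by blast
  ultimately have "card (boundaries X d) = card (boundaries L d) * card (boundaries (X - L) d)"
    using Z[of "Suc d"] by simp
  then show ?thesis
    using Z[of d] assms(4,5) by (simp add: betti_def power_add)
qed

lemma betti_lower_acyclic:
  assumes X: "convex_cells X" and L: "lower_set L X"
    and acyclic: "(\<forall>d. betti L d 0) \<or> (\<forall>d. betti (X - L) d 0)"
    and "betti L d l" "betti (X - L) d m"
  shows "betti X d (l + m)"
proof (rule betti_lower[OF X L _ assms(4,5)])
  show "cycles (X - L) (Suc d) = boundaries (X - L) (Suc d) \<or> cycles L d = boundaries L d" for d
    using acyclic betti_0_iff[OF convex_cells_lower_set[OF X L]]
      betti_0_iff[OF convex_cells_Diff[OF X L]] by blast
qed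

section \<open>Acyclicity by toggling a vertex\<close>

definition toggle :: "'a \<Rightarrow> 'a set \<Rightarrow> 'a set" where
  "toggle x s = (if x \<in> s then s - {x} else insert x s)"

text \<open>Comparable cells share the apex \<open>v s\<close>, so \<open>X\<close> behaves like a
  disjoint union of cones, and the cone over a cycle bounds it.\<close>

lemma betti_toggle:
  assumes X: "convex_cells X"
    and toggle: "\<And>s. s \<in> X \<Longrightarrow> toggle (v s) s \<in> X"
    and v: "\<And>s t. s \<in> X \<Longrightarrow> t \<in> X \<Longrightarrow> t \<subseteq> s \<Longrightarrow> v t = v s"
  shows "betti X d 0"
proof -
  have fin: "finite X" "\<And>s. s \<in> X \<Longrightarrow> finite s"
    using X convex_cellsD by blast+
  have "c \<in> boundaries X d" if c: "c \<in> cycles X d" for c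
  proof -
    \<comment> \<open>\<open>b\<close> is the cone over the part of \<open>c\<close> that avoids the
      apex; the part containing the apex is recovered from \<open>bd X c = 0\<close>.\<close>
    define b where "b = (\<lambda>s. if s \<in> X \<and> v s \<in> s then c (s - {v s}) else 0)"
    have cX: "c \<in> cell_chains X d" and bdc: "bd X c = 0"
      using c by (auto simp: cycles_def)
    have "b \<in> cell_chains X (Suc d)"
      using cX unfolding cell_chains_def b_def mem_Collect_eq
      by (metis card_Suc_Diff1 fin(2))
    moreover have "c t = bd X b t" for t
    proof (cases "t \<in> X")
      case t: True
      show ?thesis
      proof (cases "v t \<in> t")
        case False
        have ins: "insert (v t) t \<in> X"
          using toggle[OF t] False by (simp add: toggle_def)
        have "(\<Sum>s\<in>cofaces X t. b s) = (\<Sum>s\<in>{insert (v t) t}. b s)"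
        proof (rule sum.mono_neutral_right)
          show "{insert (v t) t} \<subseteq> cofaces X t"
            using ins False fin(2)[OF t] by (auto simp: cofaces_def)
          show "\<forall>s\<in>cofaces X t - {insert (v t) t}. b s = 0"
          proof
            fix s assume s: "s \<in> cofaces X t - {insert (v t) t}"
            then have "v s = v t"
              using v[of s t] t by (auto simp: cofaces_def)
            moreover have "v t \<notin> s"
            proof
              assume "v t \<in> s"
              then have "insert (v t) t \<subseteq> s" "card (insert (v t) t) = card s"
                using s False fin(2)[OF t] by (auto simp: cofaces_def)
              then have "insert (v t) t = s"
                using s fin(2) by (intro card_subset_eq) (auto simp: cofaces_def)
              then show False
                using s by blast
            qed
            ultimately show "b s = 0"
              by (simp add: b_def)
          qed
        qed (simp add: finite_cofaces fin)
        also have "\<dots> = c t"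
          using ins False v[OF ins t] by (simp add: b_def subset_insertI v[OF ins t, symmetric])
        finally show ?thesis
          using t by (simp add: bd_def)
      next
        case True
        define u where "u = t - {v t}"
        have u: "u \<in> X" "insert (v t) u = t" "v t \<notin> u" "finite u"
          using toggle[OF t] True fin(2)[OF t] by (auto simp: u_def toggle_def)
        have vu: "v u = v t"
          using v[OF t u(1)] by (auto simp: u_def)
        have card_t: "card t = Suc (card u)"
          using card_insert_disjoint[OF u(4,3)] unfolding u(2) .
        have tu: "t \<in> cofaces X u"
          using card_t t True by (auto simp: cofaces_def u_def)
        \<comment> \<open>The cycle condition is evaluated at the base \<open>u\<close> of
          \<open>t\<close>: its cofaces other than \<open>t\<close> become the cofaces of
          \<open>t\<close> when the apex is added.\<close>
        have "0 = (\<Sum>s\<in>cofaces X u. c s)"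
          using bdc u(1) by (auto simp: bd_def fun_eq_iff split: if_splits)
        also have "\<dots> = c t + (\<Sum>s\<in>cofaces X u - {t}. c s)"
          using tu by (simp add: sum.remove finite_cofaces fin)
        also have "(\<Sum>s\<in>cofaces X u - {t}. c s) = (\<Sum>s\<in>cofaces X t. b s)"
        proof (rule sum.reindex_bij_witness[where i = "\<lambda>s. s - {v t}" and j = "insert (v t)"])
          fix s assume s: "s \<in> cofaces X u - {t}"
          then have sX: "s \<in> X" "u \<subset> s" "card s = Suc (card u)" "s \<noteq> t"
            by (auto simp: cofaces_def)
          have vs: "v s = v t"
            using v[OF sX(1) u(1)] sX(2) vu by simp
          have notin: "v t \<notin> s"
          proof
            assume "v t \<in> s"
            then have "t \<subseteq> s"
              using sX(2) unfolding u_def by blast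
            moreover have "card t = card s"
              using sX(3) card_t by simp
            ultimately have "t = s"
              by (intro card_subset_eq fin(2)[OF sX(1)])
            then show False
              using sX by blast
          qed
          then show "insert (v t) s - {v t} = s"
            by simp
          have ins: "insert (v t) s \<in> X"
            using toggle[OF sX(1)] vs notin by (simp add: toggle_def)
          have "t \<noteq> insert (v t) s"
            using notin u(3) sX(2) unfolding u_def by blast
          moreover have "t \<subseteq> insert (v t) s"
            using sX(2) unfolding u_def by blast
          moreover have "card (insert (v t) s) = Suc (card t)"
            using card_insert_disjoint[OF fin(2)[OF sX(1)] notin] sX(3) card_t by simp
          ultimately show "insert (v t) s \<in> cofaces X t"
            using ins by (auto simp only: cofaces_def)
          have "v (insert (v t) s) = v t"
            using v[OF ins sX(1)] vs by (simp add: subset_insertI)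
          then show "b (insert (v t) s) = c s"
            using ins notin by (simp add: b_def)
        next
          fix s assume s: "s \<in> cofaces X t"
          then have sX: "s \<in> X" "t \<subset> s" "card s = Suc (card t)"
            by (auto simp: cofaces_def)
          have vs: "v s = v t"
            using v[OF sX(1) t] sX(2) by simp
          have mem: "v t \<in> s"
            using True sX by blast
          then show "insert (v t) (s - {v t}) = s"
            by auto
          have "s - {v t} \<in> X"
            using toggle[OF sX(1)] vs mem by (simp add: toggle_def)
          moreover have "u \<subset> s - {v t}"
            using sX True by (auto simp: u_def)
          moreover have "card (s - {v t}) = Suc (card u)"
            using card_Diff_singleton[OF mem] sX(3) card_t by simp
          ultimately show "s - {v t} \<in> cofaces X u - {t}"
            using True by (auto simp: cofaces_def)
        qed
        finally have "c t + bd X b t = 0"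
          using t by (simp add: bd_def)
        then show ?thesis
          by (metis add_eq_0_iff id_apply uminus_bit_def)
      qed
    next
      case False
      then show ?thesis
        using cX by (auto simp: bd_def cell_chains_def)
    qed
    then have "c = bd X b"
      by (rule ext)
    ultimately show ?thesis
      unfolding boundaries_def by (metis imageI)
  qed
  then show ?thesis
    by (simp add: betti_0_iff[OF X] boundaries_subset_cycles[OF X] subset_antisym subsetI)
qed

text \<open>The apex need only agree on comparable cells of equal rank: cells of bounded rank form a
  lower set, and each layer of constant rank is acyclic by \<open>betti_toggle\<close>. This is made
  for \<open>deficient\<close>, where the apex depends on the nonconstant maps of a cell and a face
  may lose some of them.\<close>

lemma betti_toggle_ranked:
  fixes r :: "'a set \<Rightarrow> nat"
  assumes "convex_cells X"
    and "\<And>s. s \<in> X \<Longrightarrow> toggle (v s) s \<in> X \<and> r (toggle (v s) s) = r s"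
    and "\<And>s t. s \<in> X \<Longrightarrow> t \<in> X \<Longrightarrow> t \<subseteq> s \<Longrightarrow> r t \<le> r s \<and> (r t = r s \<longrightarrow> v t = v s)"
    and "\<And>s. s \<in> X \<Longrightarrow> r s \<le> N"
  shows "betti X d 0"
  using assms
proof (induction N arbitrary: X d)
  case 0
  show ?case
  proof (rule betti_toggle[where v = v])
    show "toggle (v s) s \<in> X" if "s \<in> X" for s
      using 0(2) that by blast
    show "v t = v s" if "s \<in> X" "t \<in> X" "t \<subseteq> s" for s t
      using 0(3)[OF that] 0(4) that by simp
  qed (rule 0)
next
  case (Suc N)
  define L where "L = {s \<in> X. r s \<le> N}"
  have L: "lower_set L X"
    using Suc.prems(3) le_trans unfolding lower_set_def L_def by blast
  have "betti L d 0" for d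
  proof (rule Suc.IH)
    show "convex_cells L"
      using convex_cells_lower_set[OF Suc.prems(1) L] .
    show "toggle (v s) s \<in> L \<and> r (toggle (v s) s) = r s" if "s \<in> L" for s
      using that Suc.prems(2)[of s] by (simp add: L_def)
    show "r t \<le> r s \<and> (r t = r s \<longrightarrow> v t = v s)" if "s \<in> L" "t \<in> L" "t \<subseteq> s" for s t
      using that Suc.prems(3)[of s t] by (simp add: L_def)
    show "r s \<le> N" if "s \<in> L" for s
      using that by (simp add: L_def)
  qed
  moreover have "betti (X - L) d 0" for d
  proof (rule betti_toggle[where v = v])
    have Y: "s \<in> X - L \<longleftrightarrow> s \<in> X \<and> r s = Suc N" for s
      using Suc.prems(4)[of s] by (auto simp: L_def)
    show "convex_cells (X - L)"
      using convex_cells_Diff[OF Suc.prems(1) L] .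
    show "toggle (v s) s \<in> X - L" if "s \<in> X - L" for s
      using that Suc.prems(2) unfolding Y by metis
    show "v t = v s" if "s \<in> X - L" "t \<in> X - L" "t \<subseteq> s" for s t
      using that Suc.prems(3) unfolding Y by metis
  qed
  ultimately show ?case
    using betti_lower_acyclic[OF Suc.prems(1) L, of d 0 0] by simp
qed

section \<open>Small families and the parity of chains\<close>

lemma cell_chains_empty:
  assumes "{s \<in> X. card s = d} = {}"
  shows "cell_chains X d = {0}"
proof -
  have "c = 0" if "c \<in> cell_chains X d" for c
  proof
    show "c s = 0 s" for s
      using that assms unfolding cell_chains_def zero_fun_apply mem_Collect_eq by blast
  qed
  then show ?thesis
    using zero_in_cell_chains by blast
qed

lemma boundaries_empty:
  assumes "{s \<in> X. card s = Suc d} = {}"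
  shows "boundaries X d = {0}"
  by (simp add: boundaries_def cell_chains_empty[OF assms])

lemma betti_empty:
  assumes "{s \<in> X. card s = d} = {}"
  shows "betti X d 0"
proof -
  have "cycles X d \<subseteq> {0}" "boundaries X d \<subseteq> {0}"
    using bd_in_cell_chains[of _ X d] unfolding cycles_def boundaries_def
    by (auto simp: cell_chains_empty[OF assms])
  then have "cycles X d = {0}" "boundaries X d = {0}"
    using zero_in_cycles[of X d] zero_in_boundaries[of X d] by auto
  then show ?thesis
    by (simp add: betti_def)
qed

lemma betti_singleton: "betti {s} d (if d = card s then 1 else 0)"
proof (cases "d = card s")
  case True
  have "bd {s} c = 0" for c
    by (rule ext) (auto simp: bd_def cofaces_def intro!: sum.neutral)
  then have "cycles {s} d = cell_chains {s} d"
    by (simp add: cycles_def)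
  moreover have "card (cell_chains {s} d) = 2"
  proof -
    have "{u \<in> {s}. card u = d} = {s}"
      using True by auto
    then show ?thesis
      using card_cell_chains(2)[of "{s}" d] by simp
  qed
  ultimately show ?thesis
    using True by (simp add: betti_def boundaries_empty)
next
  case False
  then show ?thesis
    using betti_empty[of "{s}" d] by auto
qed

definition ind :: "'a set set \<Rightarrow> 'a set \<Rightarrow> bit" where
  "ind T s = (if s \<in> T then 1 else 0)"

lemma ind_in_cell_chains: "T \<subseteq> {s \<in> X. card s = d} \<Longrightarrow> ind T \<in> cell_chains X d"
  by (auto simp: cell_chains_def ind_def split: if_splits)

lemma ind_empty: "ind {} = 0"
  by (rule ext) (simp add: ind_def)

lemma of_nat_bit_eq_0_iff: "(of_nat k :: bit) = 0 \<longleftrightarrow> even k"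
  by (metis bit_not_zero_iff even_of_nat_iff even_zero odd_one)

text \<open>The parity of the support is an augmentation: it kills the boundary of any cell with an
  even number of facets in \<open>X\<close>.\<close>

lemma sum_bd:
  assumes "finite X" and c: "c \<in> cell_chains X (Suc d)"
    and even: "\<And>t. t \<in> X \<Longrightarrow> card t = Suc d \<Longrightarrow> even (card {s \<in> X. card s = d \<and> s \<subset> t})"
  shows "(\<Sum>s | s \<in> X \<and> card s = d. bd X c s) = 0"
proof -
  let ?S = "{s \<in> X. card s = d}"
  have "(\<Sum>s\<in>?S. bd X c s) = (\<Sum>s\<in>?S. \<Sum>t\<in>{t \<in> X. s \<subset> t \<and> card t = Suc (card s)}. c t)"
    by (rule sum.cong) (auto simp: bd_def cofaces_def)
  also have "\<dots> = (\<Sum>t\<in>X. \<Sum>s\<in>{s \<in> ?S. s \<subset> t \<and> card t = Suc (card s)}. c t)"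
    using assms(1) by (intro sum.swap_restrict) auto
  also have "\<dots> = 0"
  proof (rule sum.neutral, rule ballI)
    fix t assume t: "t \<in> X"
    show "(\<Sum>s\<in>{s \<in> ?S. s \<subset> t \<and> card t = Suc (card s)}. c t) = 0"
    proof (cases "c t = 0")
      case False
      then have card: "card t = Suc d"
        using c by (simp add: cell_chains_def)
      then have "{s \<in> ?S. s \<subset> t \<and> card t = Suc (card s)} = {s \<in> X. card s = d \<and> s \<subset> t}"
        by auto
      then have "even (card {s \<in> ?S. s \<subset> t \<and> card t = Suc (card s)})"
        using even[OF t card] by simp
      then show ?thesis
        by (simp only: sum_constant of_nat_bit_eq_0_iff[THEN iffD2] mult_zero_left)
    qed (simp only: sum.neutral_const)
  qed
  finally show ?thesis .
qed

text \<open>The boundaries are the chains with even support, a subgroup of index 2. Evenness of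
  facets gives one inclusion, and pairing every cell with the base cell \<open>x\<close> gives the
  other.\<close>

lemma betti_connected:
  assumes fin: "finite X" and x: "x \<in> X" "card x = d"
    and connected: "\<And>s. s \<in> X \<Longrightarrow> card s = d \<Longrightarrow> ind {s} + ind {x} \<in> boundaries X d"
    and even: "\<And>t. t \<in> X \<Longrightarrow> card t = Suc d \<Longrightarrow> even (card {s \<in> X. card s = d \<and> s \<subset> t})"
  shows "card (cell_chains X d) = 2 * card (boundaries X d)"
proof -
  let ?S = "{s \<in> X. card s = d}"
  define \<pi> where "\<pi> c = (\<Sum>s\<in>?S. c s)" for c :: "'a set \<Rightarrow> bit"
  have finS: "finite ?S"
    using fin by simp
  have \<pi>_add: "\<pi> (c + c') = \<pi> c + \<pi> c'" for c c'
    unfolding \<pi>_def plus_fun_apply by (rule sum.distrib)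
  \<comment> \<open>Modulo boundaries each cell may be replaced by \<open>x\<close>; the copies of
    \<open>x\<close> cancel in pairs, and one is left if the support is odd.\<close>
  have ind: "ind T + (if even (card T) then 0 else ind {x}) \<in> boundaries X d"
    if "finite T" "T \<subseteq> ?S" for T
    using that
  proof (induction T rule: finite_induct)
    case empty
    show ?case
      by (simp only: ind_empty card.empty even_zero if_True add_0_right zero_in_boundaries)
  next
    case (insert y T)
    let ?r = "if even (card T) then 0 else ind {x}"
    have eq: "ind (insert y T) + (if even (card (insert y T)) then 0 else ind {x})
        = (ind {y} + ind {x}) + (ind T + ?r)"
    proof (rule ext)
      fix s
      show "(ind (insert y T) + (if even (card (insert y T)) then 0 else ind {x})) s
        = ((ind {y} + ind {x}) + (ind T + ?r)) s"
        using insert.hyps by (auto simp: ind_def)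
    qed
    show ?case
      unfolding eq
    proof (rule boundaries_add)
      show "ind {y} + ind {x} \<in> boundaries X d"
        using connected insert.prems by blast
      show "ind T + ?r \<in> boundaries X d"
        using insert.IH insert.prems by blast
    qed
  qed
  have ker: "{c \<in> cell_chains X d. \<pi> c = 0} = boundaries X d"
  proof (intro equalityI subsetI)
    fix c assume "c \<in> boundaries X d"
    then obtain b where b: "b \<in> cell_chains X (Suc d)" "c = bd X b"
      by (auto simp: boundaries_def)
    have "\<pi> c = 0"
      unfolding \<pi>_def b(2) by (rule sum_bd[OF fin b(1) even])
    then show "c \<in> {c \<in> cell_chains X d. \<pi> c = 0}"
      using bd_in_cell_chains[OF b(1)] b(2) by simp
  next
    fix c assume c: "c \<in> {c \<in> cell_chains X d. \<pi> c = 0}"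
    define T where "T = {s. c s \<noteq> 0}"
    have T: "T \<subseteq> ?S"
      using c unfolding T_def cell_chains_def by blast
    have c_eq: "c = ind T"
      by (rule ext) (auto simp: T_def ind_def)
    have "\<pi> c = (\<Sum>s\<in>T. 1)"
      unfolding \<pi>_def c_eq by (rule sum.mono_neutral_cong_right[OF finS T]) (auto simp: ind_def)
    then have "even (card T)"
      using c of_nat_bit_eq_0_iff[of "card T"] by simp
    then show "c \<in> boundaries X d"
      using ind[OF finite_subset[OF T finS] T] c_eq by simp
  qed
  have "\<pi> (ind {x}) = (\<Sum>s\<in>{x}. 1)"
    unfolding \<pi>_def by (rule sum.mono_neutral_cong_right[OF finS]) (use x in \<open>auto simp: ind_def\<close>)
  then have one: "\<pi> (ind {x}) = 1"
    by simp
  have "ind {x} \<in> cell_chains X d"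
    using x by (intro ind_in_cell_chains) auto
  then have "1 \<in> \<pi> ` cell_chains X d"
    using one by (metis imageI)
  moreover have "0 \<in> \<pi> ` cell_chains X d"
    by (rule image_eqI[of _ _ 0]) (simp_all add: \<pi>_def)
  ultimately have "\<pi> ` cell_chains X d = {0, 1}"
    by auto
  then have "card (\<pi> ` cell_chains X d) = 2"
    by simp
  moreover have "card (cell_chains X d)
      = card {c \<in> cell_chains X d. \<pi> c = 0} * card (\<pi> ` cell_chains X d)"
    by (rule card_kernel_times_image)
      (simp_all add: card_cell_chains(1)[OF fin] cell_chains_add \<pi>_add)
  ultimately show ?thesis
    using ker by simp
qed

lemma homologous_trans:
  assumes "ind a + ind b \<in> boundaries X d" "ind b + ind c \<in> boundaries X d"
  shows "ind a + ind c \<in> boundaries X d"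
proof -
  have "ind a + ind c = (ind a + ind b) + (ind b + ind c)"
    by (rule ext) (auto simp: ind_def)
  then show ?thesis
    using boundaries_add[OF assms] by simp
qed

section \<open>From reduced to unreduced homology\<close>

lemma cell_chains_Diff_empty: "cell_chains (X - {{}}) (Suc d) = cell_chains X (Suc d)"
proof -
  have "card s = Suc d \<Longrightarrow> s \<noteq> {}" for s :: "'a set"
    by auto
  then show ?thesis
    unfolding cell_chains_def by blast
qed

lemma bd_Diff_empty:
  assumes c: "c \<in> cell_chains X (Suc (Suc d))"
  shows "bd (X - {{}}) c = bd X c"
proof
  fix t
  show "bd (X - {{}}) c t = bd X c t"
  proof (cases "t = {}")
    case True
    have "bd X c \<in> cell_chains X (Suc d)"
      by (rule bd_in_cell_chains[OF c])
    then have "bd X c {} = 0"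
      by (auto simp: cell_chains_def)
    with True show ?thesis
      by (simp add: bd_def)
  next
    case False
    then have "cofaces (X - {{}}) t = cofaces X t"
      by (auto simp: cofaces_def)
    with False show ?thesis
      by (simp add: bd_def)
  qed
qed

lemma boundaries_Diff_empty: "boundaries (X - {{}}) (Suc d) = boundaries X (Suc d)"
  unfolding boundaries_def cell_chains_Diff_empty using bd_Diff_empty by (metis image_cong)

lemma betti_Diff_empty:
  assumes "betti X (Suc (Suc d)) m"
  shows "betti (X - {{}}) (Suc (Suc d)) m"
proof -
  have "cycles (X - {{}}) (Suc (Suc d)) = cycles X (Suc (Suc d))"
    unfolding cycles_def cell_chains_Diff_empty using bd_Diff_empty by metis
  then show ?thesis
    using assms by (simp add: betti_def boundaries_Diff_empty)
qed

text \<open>Without the cell \<open>{}\<close> every chain of vertices is a cycle. With it, the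
  cycles are the kernel of the augmentation, whose image has order 2. The boundaries of edges agree,
  so the rank grows by one.\<close>

lemma betti_Diff_empty_1:
  assumes cells: "convex_cells X" and X: "{} \<in> X" "{v} \<in> X" and betti: "betti X 1 m"
  shows "betti (X - {{}}) 1 (Suc m)"
proof -
  have fin: "finite X"
    using cells by (rule convex_cellsD)
  have empty: "{s \<in> X. card s = 0} = {{}}"
    using convex_cellsD(2)[OF cells] X(1) by auto
  then have "{s \<in> X - {{}}. card s = 0} = {}"
    by blast
  then have "bd (X - {{}}) c = 0" if "c \<in> cell_chains (X - {{}}) (Suc 0)" for c
    using bd_in_cell_chains[OF that] cell_chains_empty by blast
  then have "cycles (X - {{}}) (Suc 0) = cell_chains (X - {{}}) (Suc 0)"
    by (auto simp: cycles_def)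
  then have cycles: "cycles (X - {{}}) 1 = cell_chains X (Suc 0)"
    by (simp add: cell_chains_Diff_empty)
  have "bd X (ind {{v}}) {} = (\<Sum>s\<in>cofaces X {}. if s = {v} then 1 else 0)"
    using X(1) by (simp add: bd_def ind_def)
  also have "\<dots> = 1"
  proof -
    have "{v} \<in> cofaces X {}"
      using X(2) by (auto simp: cofaces_def)
    then show ?thesis
      using finite_cofaces[OF fin, of "{}"] by (simp add: sum.delta)
  qed
  finally have "bd X (ind {{v}}) \<noteq> 0"
    by (metis zero_fun_apply zero_neq_one)
  then have "card {0, bd X (ind {{v}})} = 2"
    by (metis card_2_iff)
  moreover have "bd X (ind {{v}}) \<in> boundaries X 0"
    unfolding boundaries_def using X(2) by (intro imageI ind_in_cell_chains) simp
  then have "card {0, bd X (ind {{v}})} \<le> card (boundaries X 0)"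
    using zero_in_boundaries by (intro card_mono finite_boundaries[OF fin]) simp
  moreover have "boundaries X 0 \<subseteq> cell_chains X 0"
    using bd_in_cell_chains unfolding boundaries_def by (rule image_subsetI)
  then have "card (boundaries X 0) \<le> 2"
    using card_mono[OF card_cell_chains(1)[OF fin] \<open>boundaries X 0 \<subseteq> _\<close>]
      card_cell_chains(2)[OF fin, of 0] empty by simp
  ultimately have "card (boundaries X 0) = 2"
    by simp
  then show ?thesis
    using betti cycles card_cycles_times_boundaries[OF fin, of 0] boundaries_Diff_empty[of X 0]
    by (simp add: betti_def)
qed

section \<open>Betti numbers determine simplicial homology\<close>

lemma carrier_Z2: "carrier Z2 = {0, 1}"
  by (auto simp: carrier_integer_mod_group)

lemma carrier_Z2_power: "carrier (Z2_power m) = {..<m} \<rightarrow>\<^sub>E {0, 1}"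
  by (simp add: Z2_power_def carrier_Z2)

lemma mult_Z2_power: "x \<otimes>\<^bsub>Z2_power m\<^esub> y = (\<lambda>i\<in>{..<m}. (x i + y i) mod 2)"
  by (simp add: Z2_power_def)

lemma card_Z2_power: "card (carrier (Z2_power m)) = 2 ^ m"
  by (simp add: carrier_Z2_power card_PiE numeral_2_eq_2)

lemma group_Z2_power: "group (Z2_power m)"
  by (simp add: Z2_power_def)

text \<open>Induction on \<open>j\<close>: while \<open>2 ^ j\<close> is below the order of
  \<open>G\<close>, some \<open>a\<close> lies outside the image, and mapping the new coordinate to
  \<open>a\<close> extends the embedding.\<close>

lemma elementary_abelian_2_group_embedding:
  fixes G (structure)
  assumes "comm_group G" and fin: "finite (carrier G)"
    and sq: "\<And>x. x \<in> carrier G \<Longrightarrow> x \<otimes> x = \<one>" and order: "order G = 2 ^ m" and "j \<le> m"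
  shows "\<exists>\<phi>\<in>hom (Z2_power j) G. inj_on \<phi> (carrier (Z2_power j))"
  using \<open>j \<le> m\<close>
proof (induction j)
  case 0
  interpret comm_group G by fact
  have "(\<lambda>_. \<one>) \<in> hom (Z2_power 0) G"
    by (rule homI) auto
  moreover have "inj_on (\<lambda>_. \<one>) (carrier (Z2_power 0))"
    by (auto simp: carrier_Z2_power)
  ultimately show ?case
    by blast
next
  case (Suc j)
  interpret comm_group G by fact
  obtain \<phi> where \<phi>: "\<phi> \<in> hom (Z2_power j) G" and inj: "inj_on \<phi> (carrier (Z2_power j))"
    using Suc by auto
  have "card (\<phi> ` carrier (Z2_power j)) < card (carrier G)"
    using Suc.prems order by (simp add: card_image[OF inj] card_Z2_power order_def)
  moreover have "\<phi> ` carrier (Z2_power j) \<subseteq> carrier G"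
    using hom_in_carrier[OF \<phi>] by blast
  ultimately obtain a where a: "a \<in> carrier G" "a \<notin> \<phi> ` carrier (Z2_power j)"
    by (metis less_irrefl subsetI subset_antisym)
  define p where "p x = restrict x {..<j}" for x :: "nat \<Rightarrow> int"
  define \<psi> where "\<psi> x = \<phi> (p x) \<otimes> (if x j = 1 then a else \<one>)" for x :: "nat \<Rightarrow> int"
  have p: "p x \<in> carrier (Z2_power j)" if "x \<in> carrier (Z2_power (Suc j))" for x
    using that by (auto simp: p_def carrier_Z2_power PiE_iff)
  have \<phi>_carrier: "\<phi> (p x) \<in> carrier G" if "x \<in> carrier (Z2_power (Suc j))" for x
    using hom_in_carrier[OF \<phi> p[OF that]] .
  have last: "x j \<in> {0, 1}" if "x \<in> carrier (Z2_power (Suc j))" for x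
    using that PiE_mem[of x "{..<Suc j}" "\<lambda>_. {0, 1}" j] by (simp add: carrier_Z2_power)
  have "\<psi> \<in> hom (Z2_power (Suc j)) G"
  proof (rule homI)
    fix x assume "x \<in> carrier (Z2_power (Suc j))"
    then show "\<psi> x \<in> carrier G"
      using \<phi>_carrier a by (simp add: \<psi>_def)
  next
    fix x y assume xy: "x \<in> carrier (Z2_power (Suc j))" "y \<in> carrier (Z2_power (Suc j))"
    have "p (x \<otimes>\<^bsub>Z2_power (Suc j)\<^esub> y) = p x \<otimes>\<^bsub>Z2_power j\<^esub> p y"
      by (auto simp: p_def mult_Z2_power)
    then have "\<phi> (p (x \<otimes>\<^bsub>Z2_power (Suc j)\<^esub> y)) = \<phi> (p x) \<otimes> \<phi> (p y)"
      using hom_mult[OF \<phi> p[OF xy(1)] p[OF xy(2)]] by simp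
    moreover have "(x \<otimes>\<^bsub>Z2_power (Suc j)\<^esub> y) j = (x j + y j) mod 2"
      by (simp add: mult_Z2_power)
    moreover have "(if (x j + y j) mod 2 = 1 then a else \<one>)
        = (if x j = 1 then a else \<one>) \<otimes> (if y j = 1 then a else \<one>)"
      using last[OF xy(1)] last[OF xy(2)] a sq by auto
    ultimately show "\<psi> (x \<otimes>\<^bsub>Z2_power (Suc j)\<^esub> y) = \<psi> x \<otimes> \<psi> y"
      using \<phi>_carrier[OF xy(1)] \<phi>_carrier[OF xy(2)] a unfolding \<psi>_def
      by (simp add: m_ac)
  qed
  moreover have "inj_on \<psi> (carrier (Z2_power (Suc j)))"
  proof (rule inj_onI)
    \<comment> \<open>If the last coordinates differ, solving for \<open>a\<close> (all squares are
      trivial) puts it into the old image.\<close>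
    have diff: False if xy: "x \<in> carrier (Z2_power (Suc j))" "y \<in> carrier (Z2_power (Suc j))"
      and eq: "\<psi> x = \<psi> y" and "x j = 1" "y j = 0" for x y
    proof -
      have "\<phi> (p x) \<otimes> a = \<phi> (p y)"
        using eq that(4,5) \<phi>_carrier[OF xy(2)] by (simp add: \<psi>_def)
      then have "\<phi> (p x) \<otimes> (\<phi> (p x) \<otimes> a) = \<phi> (p x) \<otimes> \<phi> (p y)"
        by simp
      then have "a = \<phi> (p x) \<otimes> \<phi> (p y)"
        using \<phi>_carrier[OF xy(1)] a sq by (simp flip: m_assoc)
      also have "\<dots> = \<phi> (p x \<otimes>\<^bsub>Z2_power j\<^esub> p y)"
        using hom_mult[OF \<phi> p[OF xy(1)] p[OF xy(2)]] by simp
      finally show False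
        using a(2) monoid.m_closed[OF group.is_monoid[OF group_Z2_power] p[OF xy(1)] p[OF xy(2)]]
        by blast
    qed
    fix x y assume xy: "x \<in> carrier (Z2_power (Suc j))" "y \<in> carrier (Z2_power (Suc j))"
      and eq: "\<psi> x = \<psi> y"
    have j: "x j = y j"
      using last[OF xy(1)] last[OF xy(2)] diff[OF xy eq] diff[OF xy(2,1) eq[symmetric]] by auto
    then have "\<phi> (p x) = \<phi> (p y)"
      using eq \<phi>_carrier[OF xy(1)] \<phi>_carrier[OF xy(2)] a by (auto simp: \<psi>_def split: if_splits)
    then have "p x = p y"
      using inj p xy by (meson inj_onD)
    show "x = y"
    proof (rule PiE_ext)
      show "x i = y i" if "i \<in> {..<Suc j}" for i
        using that j \<open>p x = p y\<close> by (cases "i = j") (auto simp: p_def fun_eq_iff dest: spec[of _ i])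
    qed (use xy in \<open>auto simp: carrier_Z2_power\<close>)
  qed
  ultimately show ?case
    by blast
qed

lemma elementary_abelian_2_group_iso:
  fixes G (structure)
  assumes "comm_group G" "finite (carrier G)"
    and "\<And>x. x \<in> carrier G \<Longrightarrow> x \<otimes> x = \<one>" and order: "order G = 2 ^ m"
  shows "G \<cong> Z2_power m"
proof -
  obtain \<phi> where \<phi>: "\<phi> \<in> hom (Z2_power m) G" and inj: "inj_on \<phi> (carrier (Z2_power m))"
    using elementary_abelian_2_group_embedding[OF assms order_refl] by blast
  have "\<phi> ` carrier (Z2_power m) = carrier G"
    using hom_in_carrier[OF \<phi>] assms(2) order
    by (intro card_subset_eq) (auto simp: card_image[OF inj] card_Z2_power order_def)
  then have "\<phi> \<in> iso (Z2_power m) G"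
    using \<phi> inj by (simp add: iso_def bij_betw_def)
  then show ?thesis
    using group.iso_sym[OF group_Z2_power] is_isoI by blast
qed

lemma Z2_iso_Z2_power: "Z2 \<cong> Z2_power 1"
proof (rule elementary_abelian_2_group_iso)
  show "x \<otimes>\<^bsub>Z2\<^esub> x = \<one>\<^bsub>Z2\<^esub>" if "x \<in> carrier Z2" for x
    using that by (auto simp: carrier_Z2)
qed (auto simp: carrier_Z2 order_def)

lemma trivial_Z2_power_0: "trivial_group (Z2_power 0)"
  by (simp add: Z2_power_def trivial_product_group)

section \<open>Comparison of integer-valued and bit-valued chains\<close>

definition mod2 :: "'a set set \<Rightarrow> ('a set \<Rightarrow> int) \<Rightarrow> 'a set \<Rightarrow> bit" where
  "mod2 S c s = (if s \<in> S then of_int (c s) else 0)"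

lemma of_int_mod_2: "(of_int (a mod 2) :: bit) = of_int a"
  by (cases "even a") (auto elim!: evenE oddE)

lemma group_simplicial_chain_group: "comm_group (simplicial_chain_group k X)"
proof (rule group.group_comm_groupI)
  show "x \<otimes>\<^bsub>simplicial_chain_group k X\<^esub> y = y \<otimes>\<^bsub>simplicial_chain_group k X\<^esub> x" for x y
    by (simp add: simplicial_chain_group_def add.commute)
qed (simp add: simplicial_chain_group_def)

lemma carrier_simplicial_chain_group:
  assumes "finite X"
  shows "carrier (simplicial_chain_group k X) = simplices k X \<rightarrow>\<^sub>E {0, 1}"
proof -
  have "finite {i \<in> simplices k X. P i}" for P
    using assms by (auto simp: simplices_def)
  then show ?thesis
    by (auto simp: simplicial_chain_group_def carrier_sum_group carrier_Z2)
qed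

lemma mod2_mult:
  "mod2 (simplices k X) (x \<otimes>\<^bsub>simplicial_chain_group k X\<^esub> y)
    = mod2 (simplices k X) x + mod2 (simplices k X) y"
  by (rule ext) (simp add: mod2_def simplicial_chain_group_def of_int_mod_2 del: add_bit_eq_xor)

text \<open>Elements of the simplicial chain group are extensional, hence \<open>undefined\<close>
  off the simplices, whereas bit-valued chains vanish there; the two maps translate between these
  conventions.\<close>

lemma mod2_bij_betw:
  assumes "finite X" "simplices k X = {s \<in> X. card s = d}"
  shows "bij_betw (mod2 (simplices k X)) (carrier (simplicial_chain_group k X)) (cell_chains X d)"
  unfolding carrier_simplicial_chain_group[OF assms(1)]
proof (rule bij_betwI[where g = "\<lambda>c. \<lambda>s\<in>simplices k X. if c s = 0 then 0 else 1"])
  show "mod2 (simplices k X) \<in> (simplices k X \<rightarrow>\<^sub>E {0, 1}) \<rightarrow> cell_chains X d"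
    using assms(2) by (auto simp: mod2_def cell_chains_def split: if_splits)
  show "(\<lambda>c. \<lambda>s\<in>simplices k X. if c s = 0 then 0 else 1) \<in> cell_chains X d \<rightarrow> (simplices k X \<rightarrow>\<^sub>E {0, 1})"
    by auto
  show "(\<lambda>s\<in>simplices k X. if mod2 (simplices k X) c s = 0 then 0 else 1) = c"
    if "c \<in> simplices k X \<rightarrow>\<^sub>E {0, 1}" for c
  proof
    fix s
    show "(\<lambda>s\<in>simplices k X. if mod2 (simplices k X) c s = 0 then 0 else 1) s = c s"
      using PiE_mem[OF that, of s] PiE_arb[OF that, of s] by (auto simp: mod2_def)
  qed
  show "mod2 (simplices k X) (\<lambda>s\<in>simplices k X. if c s = 0 then 0 else 1) = c"
    if "c \<in> cell_chains X d" for c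
  proof
    fix s
    show "mod2 (simplices k X) (\<lambda>s\<in>simplices k X. if c s = 0 then 0 else 1) s = c s"
      using that assms(2) by (auto simp: mod2_def cell_chains_def)
  qed
qed

lemma mod2_boundary:
  assumes "finite X" "simplices k X = {s \<in> X. card s = Suc d}"
    and "simplices (k - 1) X = {s \<in> X. card s = d}"
    and c: "c \<in> carrier (simplicial_chain_group k X)"
  shows "mod2 (simplices (k - 1) X) (simplicial_boundary k X c) = bd X (mod2 (simplices k X) c)"
proof
  fix t
  let ?c = "mod2 (simplices k X) c"
  have mem: "?c \<in> cell_chains X (Suc d)"
    using bij_betw_apply[OF mod2_bij_betw[OF assms(1,2)] c] .
  show "mod2 (simplices (k - 1) X) (simplicial_boundary k X c) t = bd X ?c t"
  proof (cases "t \<in> simplices (k - 1) X")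
    case True
    then have t: "t \<in> X" "card t = d"
      using assms(3) by auto
    let ?S = "{s \<in> simplices k X. c s \<noteq> 0 \<and> t \<subseteq> s}"
    have "mod2 (simplices (k - 1) X) (simplicial_boundary k X c) t = (\<Sum>s\<in>?S. of_int (c s))"
      using True by (simp add: mod2_def simplicial_boundary_def of_int_mod_2)
    also have "\<dots> = (\<Sum>s\<in>?S. ?c s)"
      by (rule sum.cong) (auto simp: mod2_def)
    also have "\<dots> = (\<Sum>s\<in>cofaces X t. ?c s)"
    proof (rule sum.mono_neutral_left)
      show "?S \<subseteq> cofaces X t"
        using t assms(2) by (auto simp: cofaces_def)
      show "\<forall>s\<in>cofaces X t - ?S. ?c s = 0"
        using t assms(2) by (auto simp: cofaces_def mod2_def)
    qed (simp add: finite_cofaces assms(1))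
    also have "\<dots> = bd X ?c t"
      using t by (simp add: bd_def)
    finally show ?thesis .
  next
    case False
    then show ?thesis
      using bd_in_cell_chains[OF mem] assms(3) unfolding cell_chains_def mod2_def by auto
  qed
qed

lemma simplices_eq:
  assumes "convex_cells X" "{} \<notin> X" "k + 1 = int d"
  shows "simplices k X = {s \<in> X. card s = d}"
  using assms by (auto simp: simplices_def convex_cells_def)

lemma simplicial_boundary_in_carrier:
  assumes "finite X"
  shows "simplicial_boundary k X c \<in> carrier (simplicial_chain_group (k - 1) X)"
  by (auto simp: carrier_simplicial_chain_group[OF assms] simplicial_boundary_def)

lemma simplicial_cycles_eq:
  assumes "convex_cells X" "{} \<notin> X"
  shows "simplicial_cycles (int d) X = {x \<in> carrier (simplicial_chain_group (int d) X).
    mod2 (simplices (int d) X) x \<in> cycles X (Suc d)}"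
proof -
  have fin: "finite X"
    using assms convex_cellsD by blast
  have k: "simplices (int d) X = {s \<in> X. card s = Suc d}" "simplices (int d - 1) X = {s \<in> X. card s = d}"
    using simplices_eq[OF assms] by auto
  have inj: "inj_on (mod2 (simplices (int d - 1) X)) (carrier (simplicial_chain_group (int d - 1) X))"
    using mod2_bij_betw[OF fin k(2)] by (rule bij_betw_imp_inj_on)
  have one: "mod2 (simplices (int d - 1) X) \<one>\<^bsub>simplicial_chain_group (int d - 1) X\<^esub> = 0"
    by (rule ext) (simp add: mod2_def simplicial_chain_group_def)
  have "simplicial_boundary (int d) X x = \<one>\<^bsub>simplicial_chain_group (int d - 1) X\<^esub>
      \<longleftrightarrow> bd X (mod2 (simplices (int d) X) x) = 0"
    if x: "x \<in> carrier (simplicial_chain_group (int d) X)" for x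
    using inj_on_eq_iff[OF inj simplicial_boundary_in_carrier[OF fin]
        group.subgroup_self[THEN subgroup.one_closed]]
      group_simplicial_chain_group[THEN comm_group.axioms(2)]
    unfolding mod2_boundary[OF fin k x, symmetric] one[symmetric] by metis
  then show ?thesis
    using bij_betw_apply[OF mod2_bij_betw[OF fin k(1)]]
    by (auto simp: simplicial_cycles_def kernel_def cycles_def)
qed

lemma simplicial_boundaries_eq:
  assumes "convex_cells X" "{} \<notin> X"
  shows "simplicial_boundaries (int d) X = {x \<in> carrier (simplicial_chain_group (int d) X).
    mod2 (simplices (int d) X) x \<in> boundaries X (Suc d)}"
proof -
  have fin: "finite X"
    using assms convex_cellsD by blast
  define k where "k = int d + 1"
  have k: "simplices k X = {s \<in> X. card s = Suc (Suc d)}" "simplices (k - 1) X = {s \<in> X. card s = Suc d}"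
    using simplices_eq[OF assms] by (auto simp: k_def)
  note bd = mod2_boundary[OF fin k]
  have inj: "inj_on (mod2 (simplices (k - 1) X)) (carrier (simplicial_chain_group (k - 1) X))"
    using mod2_bij_betw[OF fin k(2)] by (rule bij_betw_imp_inj_on)
  have surj: "mod2 (simplices k X) ` carrier (simplicial_chain_group k X) = cell_chains X (Suc (Suc d))"
    using mod2_bij_betw[OF fin k(1)] by (rule bij_betw_imp_surj_on)
  have "simplicial_boundary k X ` carrier (simplicial_chain_group k X) =
      {x \<in> carrier (simplicial_chain_group (k - 1) X). mod2 (simplices (k - 1) X) x \<in> boundaries X (Suc d)}"
  proof (intro equalityI subsetI)
    fix x assume "x \<in> simplicial_boundary k X ` carrier (simplicial_chain_group k X)"
    then obtain c where c: "c \<in> carrier (simplicial_chain_group k X)" "x = simplicial_boundary k X c"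
      by blast
    then have "mod2 (simplices (k - 1) X) x \<in> boundaries X (Suc d)"
      using bd[OF c(1)] surj unfolding boundaries_def by (metis imageI)
    then show "x \<in> {x \<in> carrier (simplicial_chain_group (k - 1) X).
        mod2 (simplices (k - 1) X) x \<in> boundaries X (Suc d)}"
      using simplicial_boundary_in_carrier[OF fin] c by blast
  next
    fix x assume "x \<in> {x \<in> carrier (simplicial_chain_group (k - 1) X).
        mod2 (simplices (k - 1) X) x \<in> boundaries X (Suc d)}"
    then have x: "x \<in> carrier (simplicial_chain_group (k - 1) X)"
      and "mod2 (simplices (k - 1) X) x \<in> bd X ` cell_chains X (Suc (Suc d))"
      by (auto simp: boundaries_def)
    then obtain c where c: "c \<in> carrier (simplicial_chain_group k X)"
      "mod2 (simplices (k - 1) X) x = bd X (mod2 (simplices k X) c)"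
      unfolding surj[symmetric] by blast
    then have "x = simplicial_boundary k X c"
      using inj_onD[OF inj _ x simplicial_boundary_in_carrier[OF fin]] bd[OF c(1)] by simp
    with c show "x \<in> simplicial_boundary k X ` carrier (simplicial_chain_group k X)"
      by blast
  qed
  then show ?thesis
    by (simp add: simplicial_boundaries_def k_def)
qed

lemma simplicial_chain_square:
  assumes "x \<in> carrier (simplicial_chain_group k X)"
  shows "x \<otimes>\<^bsub>simplicial_chain_group k X\<^esub> x = \<one>\<^bsub>simplicial_chain_group k X\<^esub>"
  by (auto simp: simplicial_chain_group_def)

lemma subgroup_mod2:
  assumes "0 \<in> T" "\<And>x y. x \<in> T \<Longrightarrow> y \<in> T \<Longrightarrow> x + y \<in> T"
  shows "subgroup {x \<in> carrier (simplicial_chain_group k X). mod2 (simplices k X) x \<in> T}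
    (simplicial_chain_group k X)"
proof -
  interpret G: comm_group "simplicial_chain_group k X"
    by (rule group_simplicial_chain_group)
  have one: "mod2 (simplices k X) \<one>\<^bsub>simplicial_chain_group k X\<^esub> = 0"
    by (rule ext) (simp add: mod2_def simplicial_chain_group_def)
  have inv: "inv\<^bsub>simplicial_chain_group k X\<^esub> x = x" if "x \<in> carrier (simplicial_chain_group k X)" for x
    using G.inv_equality[OF simplicial_chain_square that that] that by blast
  show ?thesis
    by (rule G.subgroupI) (use assms one inv mod2_mult[of k X] G.one_closed in \<open>auto\<close>)
qed

text \<open>The quotient has exponent 2, and by Lagrange its order is the ratio of the two counts in
  \<open>betti\<close>; this determines it up to isomorphism.\<close>

lemma simplicial_homology_iso:
  assumes X: "convex_cells X" "{} \<notin> X" and betti: "betti X (Suc d) m"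
  shows "group (simplicial_homology (int d) X)"
    and "simplicial_homology (int d) X \<cong> Z2_power m"
proof -
  let ?G = "simplicial_chain_group (int d) X"
  let ?Z = "simplicial_cycles (int d) X" and ?B = "simplicial_boundaries (int d) X"
  interpret G: comm_group ?G
    by (rule group_simplicial_chain_group)
  have fin: "finite X"
    using X convex_cellsD by blast
  have k: "simplices (int d) X = {s \<in> X. card s = Suc d}"
    using simplices_eq[OF X] by auto
  note bij = mod2_bij_betw[OF fin k]
  have card: "card {x \<in> carrier ?G. mod2 (simplices (int d) X) x \<in> T} = card T"
    if "T \<subseteq> cell_chains X (Suc d)" for T
  proof -
    have "bij_betw (mod2 (simplices (int d) X)) {x \<in> carrier ?G. mod2 (simplices (int d) X) x \<in> T} T"
    proof (rule bij_betw_imageI)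
      show "inj_on (mod2 (simplices (int d) X)) {x \<in> carrier ?G. mod2 (simplices (int d) X) x \<in> T}"
        using bij_betw_imp_inj_on[OF bij] by (rule inj_on_subset) blast
      have "c \<in> mod2 (simplices (int d) X) ` carrier ?G" if "c \<in> T" for c
        using \<open>T \<subseteq> _\<close> that unfolding bij_betw_imp_surj_on[OF bij] by (rule subsetD)
      then show "mod2 (simplices (int d) X) ` {x \<in> carrier ?G. mod2 (simplices (int d) X) x \<in> T} = T"
        by auto
    qed
    then show ?thesis
      by (rule bij_betw_same_card)
  qed
  have Z: "subgroup ?Z ?G" and B: "subgroup ?B ?G"
    unfolding simplicial_cycles_eq[OF X] simplicial_boundaries_eq[OF X]
    by (rule subgroup_mod2; simp add: zero_in_cycles cycles_add zero_in_boundaries boundaries_add)+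
  have BZ: "?B \<subseteq> ?Z"
    unfolding simplicial_cycles_eq[OF X] simplicial_boundaries_eq[OF X]
    using boundaries_subset_cycles[OF X(1)] by blast
  have card_Z: "card ?Z = card (cycles X (Suc d))"
    unfolding simplicial_cycles_eq[OF X] by (rule card) (auto simp: cycles_def)
  have card_B: "card ?B = card (boundaries X (Suc d))"
    unfolding simplicial_boundaries_eq[OF X]
    using boundaries_subset_cycles[OF X(1)] by (intro card) (auto simp: cycles_def)
  let ?S = "subgroup_generated ?G ?Z"
  have carrier_S: "carrier ?S = ?Z"
    using Z by (rule subgroup.carrier_subgroup_generated_subgroup)
  interpret S: comm_group ?S
    by (rule G.abelian_subgroup_generated[OF group_simplicial_chain_group])
  have B_S: "subgroup ?B ?S"
    by (rule G.subgroup_of_subgroup_generated[OF BZ B])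
  interpret B: normal ?B ?S
    using B_S by (simp add: S.normal_iff_subgroup)
  have fin_Z: "finite ?Z"
    using card_Z finite_cycles[OF fin] zero_in_cycles card_gt_0_iff
    by (metis card.infinite empty_iff less_nat_zero_code)
  have "card (rcosets\<^bsub>?S\<^esub> ?B) * card ?B = card ?Z"
    using S.lagrange[OF B_S] by (simp add: order_def carrier_S)
  also have "\<dots> = 2 ^ m * card ?B"
    using betti by (simp add: card_Z card_B betti_def)
  finally have "card (rcosets\<^bsub>?S\<^esub> ?B) * card ?B = 2 ^ m * card ?B" .
  moreover have "card ?B \<noteq> 0"
    unfolding card_0_eq[OF finite_subset[OF BZ fin_Z]] using subgroup.one_closed[OF B] by force
  ultimately have "card (rcosets\<^bsub>?S\<^esub> ?B) = 2 ^ m"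
    by simp
  then have order: "order (?S Mod ?B) = 2 ^ m"
    by (simp add: order_def FactGroup_def)
  show "group (simplicial_homology (int d) X)"
    unfolding simplicial_homology_def by (rule B.factorgroup_is_group)
  show "simplicial_homology (int d) X \<cong> Z2_power m"
    unfolding simplicial_homology_def
  proof (rule elementary_abelian_2_group_iso)
    show "comm_group (?S Mod ?B)"
      by (rule S.abelian_FactGroup[OF B_S])
    show "finite (carrier (?S Mod ?B))"
      using order by (intro card_ge_0_finite) (simp add: order_def)
    show "x \<otimes>\<^bsub>?S Mod ?B\<^esub> x = \<one>\<^bsub>?S Mod ?B\<^esub>" if x: "x \<in> carrier (?S Mod ?B)" for x
    proof -
      obtain y where y: "y \<in> carrier ?S" "x = ?B #>\<^bsub>?S\<^esub> y"
        using x by (auto simp: carrier_FactGroup)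
      then have "y \<in> carrier ?G"
        using carrier_S subgroup.subset[OF Z] by blast
      then have "y \<otimes>\<^bsub>?S\<^esub> y = \<one>\<^bsub>?S\<^esub>"
        by (simp add: simplicial_chain_square)
      then show ?thesis
        using y B.rcos_sum[OF y(1) y(1)] S.coset_mult_one[OF B.subset] by simp
    qed
  qed (rule order)
qed

lemma simplicial_homology_trivial:
  assumes "convex_cells X" "{} \<notin> X" "betti X (Suc d) 0"
  shows "trivial_group (simplicial_homology (int d) X)"
  using isomorphic_group_triviality[OF simplicial_homology_iso(2)[OF assms]
      simplicial_homology_iso(1)[OF assms] group_Z2_power] trivial_Z2_power_0 by simp

text \<open>For \<open>k = -1\<close> the chain group one dimension higher belongs to the vertices
  and may be nontrivial, but its boundary map has values in functions on the empty set, so the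
  boundaries are trivial too.\<close>

lemma simplicial_homology_neg:
  assumes "k < 0"
  shows "trivial_group (simplicial_homology k X)"
proof -
  let ?G = "simplicial_chain_group k X"
  let ?S = "subgroup_generated ?G (simplicial_cycles k X)"
  let ?B = "simplicial_boundaries k X"
  interpret G: comm_group ?G
    by (rule group_simplicial_chain_group)
  interpret S: group ?S
    by simp
  have "int (card s) \<noteq> k + 1" if "finite s" "s \<noteq> {}" for s :: "'a set"
  proof -
    have "0 < card s"
      using that by (simp add: card_gt_0_iff)
    then show ?thesis
      using assms by linarith
  qed
  then have empty: "simplices k X = {}"
    unfolding simplices_def by blast
  have G: "carrier ?G = {\<one>\<^bsub>?G\<^esub>}"
    by (simp add: simplicial_chain_group_def carrier_sum_group empty restrict_def)
  have S: "carrier ?S = {\<one>\<^bsub>?S\<^esub>}"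
    using G.carrier_subgroup_generated_subset[of "simplicial_cycles k X"] S.one_closed G by auto
  have "carrier (simplicial_chain_group (k + 1) X) \<noteq> {}"
    using group.is_monoid[OF comm_group.axioms(2)[OF group_simplicial_chain_group]]
      monoid.one_closed by blast
  then have B: "?B = {\<one>\<^bsub>?S\<^esub>}"
    by (auto simp: simplicial_boundaries_def simplicial_boundary_def empty simplicial_chain_group_def
        restrict_def)
  interpret B: normal ?B ?S
    unfolding B by (rule S.one_is_normal)
  have "carrier (?S Mod ?B) = {\<one>\<^bsub>?S Mod ?B\<^esub>}"
    using S.coset_mult_one[OF B.subset] by (simp add: carrier_FactGroup S)
  then show ?thesis
    using B.factorgroup_is_group by (simp add: simplicial_homology_def trivial_group_def)
qed

section \<open>The neighborhood complex\<close>

text \<open>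
  \<open>I\<close> and \<open>C\<close> are the vertex sets of the source and target complete graphs. The family \<open>nbhd\<close>
  below contains the empty cell, which makes its homology reduced.
\<close>
locale exponential_complete =
  fixes I :: "'a set" and C :: "'b set"
  assumes finite_I: "finite I" and card_I: "2 \<le> card I" and card_C: "card C = Suc (card I)"
begin

definition colourings :: "('a \<Rightarrow> 'b) set" where "colourings = I \<rightarrow>\<^sub>E C"

definition const :: "'b \<Rightarrow> 'a \<Rightarrow> 'b" where "const c = (\<lambda>i\<in>I. c)"

definition colours :: "('a \<Rightarrow> 'b) set \<Rightarrow> 'b set" where "colours s = (\<Union>f\<in>s. f ` I)"

definition nbhd :: "('a \<Rightarrow> 'b) set set" where
  "nbhd = {s. s \<subseteq> colourings \<and> (\<exists>g\<in>colourings. \<forall>f\<in>s. \<forall>i\<in>I. \<forall>j\<in>I. i \<noteq> j \<longrightarrow> f i \<noteq> g j)}"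

definition deficient :: "('a \<Rightarrow> 'b) set set" where
  "deficient = {s. s \<subseteq> colourings \<and> colours s \<noteq> C}"

definition injections :: "('a \<Rightarrow> 'b) set" where "injections = {g \<in> colourings. inj_on g I}"

definition miss :: "('a \<Rightarrow> 'b) \<Rightarrow> 'b" where "miss g = the_elem (C - g ` I)"

text \<open>The neighbourhood of an injection \<open>g\<close>: at \<open>j\<close> only the colours
  \<open>g j\<close> and \<open>miss g\<close> avoid all \<open>g k\<close> with
  \<open>k \<noteq> j\<close>.\<close>

definition nbrs :: "('a \<Rightarrow> 'b) \<Rightarrow> ('a \<Rightarrow> 'b) set" where
  "nbrs g = {f \<in> colourings. \<forall>j\<in>I. f j = g j \<or> f j = miss g}"

text \<open>On injections an involution for fixed \<open>i\<close>: the overwritten colour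
  \<open>g i\<close> becomes the missing one.\<close>

definition move :: "('a \<Rightarrow> 'b) \<Rightarrow> 'a \<Rightarrow> 'a \<Rightarrow> 'b" where
  "move g i = g(i := miss g)"

text \<open>The cells that survive the matching of a simplex in \<open>nbrs g\<close> with its toggle by \<open>const (miss g)\<close>.\<close>
definition tails :: "('a \<Rightarrow> 'b) set set" where
  "tails = (\<lambda>g. {g, const (miss g)}) ` injections"

definition bridges :: "('a \<Rightarrow> 'b) set set" where
  "bridges = (\<lambda>(g, i). {g, move g i}) ` (injections \<times> I)"

definition triangles :: "('a \<Rightarrow> 'b) set set" where
  "triangles = (\<lambda>(g, i). {g, move g i, const (miss g)}) ` (injections \<times> I)"

definition critical :: "('a \<Rightarrow> 'b) set set" where
  "critical = tails \<union> bridges \<union> triangles"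

section \<open>Injective colourings and their neighbourhoods\<close>

lemma finite_C: "finite C"
  using card_C by (metis card.infinite nat.distinct(1))

lemma finite_colourings: "finite colourings"
  by (simp add: colourings_def finite_I finite_C finite_PiE)

lemma two_indices: obtains i j where "i \<in> I" "j \<in> I" "i \<noteq> j"
proof -
  have "\<not> is_singleton I" "I \<noteq> {}"
    using card_I by (auto simp: is_singleton_altdef)
  then show ?thesis
    using that by (metis all_not_in_conv is_singletonI')
qed

lemma const_colourings: "c \<in> C \<Longrightarrow> const c \<in> colourings"
  by (auto simp: const_def colourings_def)

lemma const_apply: "i \<in> I \<Longrightarrow> const c i = c"
  by (simp add: const_def)

lemma const_eq_iff: "const c = const d \<longleftrightarrow> c = d"
  using two_indices const_apply by metis

lemma colourings_eqI: "f \<in> colourings \<Longrightarrow> g \<in> colourings \<Longrightarrow> (\<And>i. i \<in> I \<Longrightarrow> f i = g i) \<Longrightarrow> f = g"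
  unfolding colourings_def by (rule PiE_ext)

lemma colourings_apply: "f \<in> colourings \<Longrightarrow> i \<in> I \<Longrightarrow> f i \<in> C"
  by (auto simp: colourings_def)

lemma colours_subset: "s \<subseteq> colourings \<Longrightarrow> colours s \<subseteq> C"
  unfolding colours_def using colourings_apply by blast

lemma colours_mono: "s \<subseteq> t \<Longrightarrow> colours s \<subseteq> colours t"
  unfolding colours_def by blast

lemma in_colours: "c \<in> colours s \<longleftrightarrow> (\<exists>f\<in>s. \<exists>i\<in>I. c = f i)"
  by (auto simp: colours_def)

lemma colours_insert: "colours (insert f s) = f ` I \<union> colours s"
  by (auto simp: colours_def)

lemma colours_empty: "colours {} = {}"
  by (simp add: colours_def)

lemma const_image: "const c ` I = {c}"
  using two_indices const_apply by (auto simp: image_iff) (metis const_apply)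

lemma injections_colourings: "g \<in> injections \<Longrightarrow> g \<in> colourings"
  by (simp add: injections_def)

lemma injections_image:
  assumes "g \<in> injections"
  shows "miss g \<in> C" "miss g \<notin> g ` I" "C = insert (miss g) (g ` I)"
proof -
  have sub: "g ` I \<subseteq> C"
    using colourings_apply injections_colourings[OF assms] by blast
  have "card (g ` I) = card I"
    using assms by (simp add: injections_def card_image)
  then have "card (C - g ` I) = 1"
    using card_C sub finite_I by (simp add: card_Diff_subset)
  then have "C - g ` I = {miss g}"
    unfolding miss_def by (metis card_1_singletonE the_elem_eq)
  then show "miss g \<in> C" "miss g \<notin> g ` I" "C = insert (miss g) (g ` I)"
    using sub by auto
qed

lemma injections_inj: "g \<in> injections \<Longrightarrow> i \<in> I \<Longrightarrow> j \<in> I \<Longrightarrow> g i = g j \<longleftrightarrow> i = j"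
  unfolding injections_def by (auto dest: inj_onD)

lemma injections_miss: "g \<in> injections \<Longrightarrow> i \<in> I \<Longrightarrow> g i \<noteq> miss g"
  using injections_image(2) by (metis imageI)

lemma injections_colours: "g \<in> injections \<Longrightarrow> colours {g} \<noteq> C"
  using injections_image[of g] by (auto simp: colours_def)

lemma missI: "g \<in> injections \<Longrightarrow> c \<in> C \<Longrightarrow> c \<notin> g ` I \<Longrightarrow> miss g = c"
  using injections_image(3)[of g] by (metis insertE)

lemma const_notin_injections: "const c \<notin> injections"
  using two_indices injections_inj const_apply by metis

lemma move_injections:
  assumes "g \<in> injections" "i \<in> I"
  shows "move g i \<in> injections" "miss (move g i) = g i" "move (move g i) i = g" "move g i \<noteq> g"
proof -
  have colourings: "move g i \<in> colourings"
    using injections_colourings[OF assms(1)] injections_image(1)[OF assms(1)] assms(2)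
    by (auto simp: move_def colourings_def PiE_iff extensional_def)
  have "inj_on (move g i) I"
    unfolding move_def inj_on_def using assms injections_miss[OF assms(1)] injections_inj[OF assms(1)]
    by (metis fun_upd_apply)
  then show injections: "move g i \<in> injections"
    using colourings by (simp add: injections_def)
  have "g i \<notin> move g i ` I"
    using assms injections_miss[OF assms(1,2)] injections_inj[OF assms(1)] by (auto simp: move_def)
  then show miss: "miss (move g i) = g i"
    using missI[OF injections] colourings_apply[OF injections_colourings[OF assms(1)] assms(2)] by blast
  show "move (move g i) i = g"
    unfolding move_def[of "move g i"] miss by (simp add: move_def)
  show "move g i \<noteq> g"
    using injections_miss[OF assms] by (metis fun_upd_same move_def)
qed

lemma nbrs_mem:
  assumes "g \<in> injections"
  shows "g \<in> nbrs g" "const (miss g) \<in> nbrs g" "i \<in> I \<Longrightarrow> move g i \<in> nbrs g"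
proof -
  show "g \<in> nbrs g" "const (miss g) \<in> nbrs g"
    using injections_colourings[OF assms] const_colourings[OF injections_image(1)[OF assms]] by (auto simp: nbrs_def const_apply)
  show "move g i \<in> nbrs g" if "i \<in> I"
    using injections_colourings[OF move_injections(1)[OF assms that]] by (auto simp: nbrs_def move_def)
qed

lemma nbrs_colourings: "nbrs g \<subseteq> colourings"
  by (auto simp: nbrs_def)

lemma nbhd_minus_deficient: "s \<in> nbhd - deficient \<longleftrightarrow> colours s = C \<and> (\<exists>g\<in>injections. s \<subseteq> nbrs g)"
proof
  assume s: "s \<in> nbhd - deficient"
  then obtain g where sV: "s \<subseteq> colourings" and colours: "colours s = C" and g: "g \<in> colourings"
    and adj: "\<And>f i j. f \<in> s \<Longrightarrow> i \<in> I \<Longrightarrow> j \<in> I \<Longrightarrow> i \<noteq> j \<Longrightarrow> f i \<noteq> g j"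
    by (auto simp: nbhd_def deficient_def)
  have "inj_on g I"
  proof (rule inj_onI, rule ccontr)
    fix i j assume ij: "i \<in> I" "j \<in> I" "g i = g j" "i \<noteq> j"
    \<comment> \<open>Every index \<open>k\<close> differs from \<open>i\<close> or from
      \<open>j\<close>, and adjacency at that index excludes the repeated colour.\<close>
    have "f k \<noteq> g i" if "f \<in> s" "k \<in> I" for f k
      using adj[OF that(1,2) ij(1)] adj[OF that(1,2) ij(2)] ij(3,4) by metis
    then have "g i \<notin> colours s"
      unfolding in_colours by metis
    then show False
      using colours colourings_apply[OF g ij(1)] by simp
  qed
  then have injections: "g \<in> injections"
    using g by (simp add: injections_def)
  have "f j = g j \<or> f j = miss g" if f: "f \<in> s" and j: "j \<in> I" for f j
  proof -
    have "f j \<in> insert (miss g) (g ` I)"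
      using colourings_apply[of f j] sV f j injections_image(3)[OF injections] by auto
    then show ?thesis
      using adj[OF f j] by auto
  qed
  then have "s \<subseteq> nbrs g"
    using sV by (auto simp: nbrs_def)
  with colours injections show "colours s = C \<and> (\<exists>g\<in>injections. s \<subseteq> nbrs g)"
    by blast
next
  assume "colours s = C \<and> (\<exists>g\<in>injections. s \<subseteq> nbrs g)"
  then obtain g where colours: "colours s = C" and injections: "g \<in> injections" and s: "s \<subseteq> nbrs g"
    by blast
  have "f i \<noteq> g j" if "f \<in> s" "i \<in> I" "j \<in> I" "i \<noteq> j" for f i j
  proof -
    have "f i = g i \<or> f i = miss g"
      using s that by (auto simp: nbrs_def)
    then show ?thesis
      using injections_inj[OF injections that(2,3)] injections_miss[OF injections that(3)] that(4) by auto
  qed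
  then show "s \<in> nbhd - deficient"
    using s nbrs_colourings[of g] injections_colourings[OF injections] colours by (auto simp: nbhd_def deficient_def)
qed

text \<open>Apart from bridges, a simplex using all colours determines its injection and thereby the
  constant map to toggle. If \<open>g j\<close> were neither \<open>h j\<close> nor
  \<open>miss h\<close>, no map of \<open>s\<close> could take this value: not at \<open>j\<close>,
  because of \<open>h\<close>, and nowhere else, because of \<open>g\<close>.\<close>

lemma nbrs_unique:
  assumes injections: "g \<in> injections" "h \<in> injections" "g \<noteq> h" and s: "s \<subseteq> nbrs g" "s \<subseteq> nbrs h" and colours: "colours s = C"
  obtains i where "i \<in> I" "h = move g i" "s = {g, h}"
proof -
  have *: "g j = h j \<or> g j = miss h" if j: "j \<in> I" for j
  proof (rule ccontr)
    assume g: "\<not> (g j = h j \<or> g j = miss h)"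
    have "f k \<noteq> g j" if f: "f \<in> s" and k: "k \<in> I" for f k
    proof (cases "k = j")
      case True
      have "f j = h j \<or> f j = miss h"
        using f s(2) j by (auto simp: nbrs_def)
      with g True show ?thesis
        by auto
    next
      case False
      have "f k = g k \<or> f k = miss g"
        using f s(1) k by (auto simp: nbrs_def)
      then show ?thesis
        using injections_inj[OF injections(1) k j] injections_miss[OF injections(1) j] False by auto
    qed
    then have "g j \<notin> colours s"
      unfolding in_colours by metis
    then show False
      using colours colourings_apply[OF injections_colourings[OF injections(1)] j] by simp
  qed
  obtain i where i: "i \<in> I" "g i \<noteq> h i"
    using colourings_eqI[OF injections_colourings[OF injections(1)] injections_colourings[OF injections(2)]] injections(3) by blast
  then have gi: "g i = miss h"
    using * by blast
  \<comment> \<open>\<open>g\<close> takes the colour \<open>miss h\<close> only once, so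
    \<open>g\<close> and \<open>h\<close> differ at \<open>i\<close> alone.\<close>
  have eq: "g j = h j" if "j \<in> I" "j \<noteq> i" for j
    using *[OF that(1)] injections_inj[OF injections(1) that(1) i(1)] that(2) gi by auto
  have "g = move h i"
    by (rule colourings_eqI) (use injections_colourings move_injections(1) injections i gi eq in \<open>auto simp: move_def\<close>)
  then have h: "h = move g i" and mg: "miss g = h i"
    using move_injections[OF injections(2) i(1)] by auto
  have "f = g \<or> f = h" if f: "f \<in> s" for f
  proof -
    \<comment> \<open>Away from \<open>i\<close> the two values allowed by \<open>g\<close> and the
      two allowed by \<open>h\<close> share only the common one, since \<open>miss g = h i\<close>
      and \<open>miss h = g i\<close> differ.\<close>
    have "f j = g j" if j: "j \<in> I" "j \<noteq> i" for j
    proof -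
      have "f j = g j \<or> f j = miss g" "f j = h j \<or> f j = miss h"
        using f s j by (auto simp: nbrs_def)
      then show ?thesis
        using eq[OF j] mg gi i(2) injections_miss[OF injections(1) j(1)] by metis
    qed
    moreover have "f i = g i \<or> f i = h i"
      using f s(1) i(1) mg by (auto simp: nbrs_def)
    moreover have "f \<in> colourings"
      using f s nbrs_colourings by blast
    ultimately show ?thesis
      using colourings_eqI[of f g] colourings_eqI[of f h] injections_colourings[OF injections(1)] injections_colourings[OF injections(2)] eq by metis
  qed
  then have sub: "s \<subseteq> {g, h}"
    by blast
  moreover have "\<not> s \<subseteq> {g}" "\<not> s \<subseteq> {h}"
    using injections_colours[OF injections(1)] injections_colours[OF injections(2)] colours colours_mono colours_subset injections_colourings[OF injections(1)] injections_colourings[OF injections(2)]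
    by (metis empty_subsetI insert_subset subset_antisym)+
  ultimately have "s = {g, h}"
    by blast
  with that i(1) h show ?thesis
    by blast
qed

section \<open>The critical cells\<close>

lemma critE:
  assumes "s \<in> critical"
  obtains (tail) g where "g \<in> injections" "s = {g, const (miss g)}"
  | (bridge) g i where "g \<in> injections" "i \<in> I" "s = {g, move g i}"
  | (triangle) g i where "g \<in> injections" "i \<in> I" "s = {g, move g i, const (miss g)}"
  using assms unfolding critical_def tails_def bridges_def triangles_def by auto

lemma critI:
  assumes "g \<in> injections"
  shows "{g, const (miss g)} \<in> critical"
    and "i \<in> I \<Longrightarrow> {g, move g i} \<in> critical"
    and "i \<in> I \<Longrightarrow> {g, move g i, const (miss g)} \<in> critical"
  using assms unfolding critical_def tails_def bridges_def triangles_def by auto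

lemma colours_tail: "g \<in> injections \<Longrightarrow> colours {g, const (miss g)} = C"
  using injections_image(3)[of g] by (simp add: colours_insert colours_empty const_image)

lemma colours_bridge:
  assumes "g \<in> injections" "i \<in> I"
  shows "colours {g, move g i} = C"
proof -
  have "miss g \<in> move g i ` I"
    using assms(2) by (auto simp: move_def)
  moreover have "move g i ` I \<subseteq> C"
    using colourings_apply[OF injections_colourings[OF move_injections(1)[OF assms]]] by blast
  moreover have "g ` I \<subseteq> C" "C \<subseteq> insert (miss g) (g ` I)"
    using injections_image(3)[OF assms(1)] by (metis subset_insertI, metis order_refl)
  moreover have "colours {g, move g i} = g ` I \<union> move g i ` I"
    by (simp add: colours_insert colours_empty)
  ultimately show ?thesis
    by blast
qed

lemma colours_between: "s \<subseteq> t \<Longrightarrow> t \<subseteq> colourings \<Longrightarrow> colours s = C \<Longrightarrow> colours t = C"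
  using colours_mono colours_subset by blast

lemma critical_subset: "critical \<subseteq> nbhd - deficient"
proof
  fix s assume "s \<in> critical"
  then show "s \<in> nbhd - deficient"
    unfolding nbhd_minus_deficient
  proof (cases rule: critE)
    case (tail g)
    then show "colours s = C \<and> (\<exists>g\<in>injections. s \<subseteq> nbrs g)"
      using nbrs_mem[of g] colours_tail by blast
  next
    case (bridge g i)
    then show "colours s = C \<and> (\<exists>g\<in>injections. s \<subseteq> nbrs g)"
      using nbrs_mem[of g] colours_bridge by blast
  next
    case (triangle g i)
    then have sub: "s \<subseteq> nbrs g" "{g, move g i} \<subseteq> s"
      using nbrs_mem[of g] by auto
    then have "colours s = C"
      using colours_between[OF sub(2) order_trans[OF sub(1) nbrs_colourings]] colours_bridge triangle by blast
    then show "colours s = C \<and> (\<exists>g\<in>injections. s \<subseteq> nbrs g)"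
      using sub triangle by blast
  qed
qed

text \<open>The move overwrites the colour \<open>g i\<close>, which is lost once \<open>g\<close>
  is dropped. Hence only two facets of a triangle are relative cells.\<close>

lemma injections_colours_const:
  assumes "g \<in> injections" "i \<in> I"
  shows "colours {move g i, const (miss g)} \<noteq> C"
proof -
  have "g i \<notin> insert (miss g) (move g i ` I)"
    using injections_image(2)[OF move_injections(1)[OF assms]] injections_miss[OF assms] move_injections(2)[OF assms] by simp
  then show ?thesis
    using colourings_apply[OF injections_colourings[OF assms(1)] assms(2)] by (auto simp: colours_insert colours_empty const_image)
qed

lemma colours_const: "colours {const c} \<noteq> C"
proof
  assume "colours {const c} = C"
  then have "card C = 1"
    by (simp add: colours_insert colours_empty const_image flip: \<open>colours {const c} = C\<close>)
  then show False
    using card_C card_I by simp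
qed

lemma C_nonempty: "C \<noteq> {}"
  using card_C by auto

text \<open>The cells left uncancelled form a relative subcomplex, so the others can be split off as
  an acyclic quotient.\<close>

lemma critical_lower: "lower_set critical (nbhd - deficient)"
  unfolding lower_set_def
proof (intro conjI ballI impI)
  show "critical \<subseteq> nbhd - deficient"
    by (rule critical_subset)
  fix s t assume s: "s \<in> critical" and t: "t \<in> nbhd - deficient" "t \<subseteq> s"
  have full: "colours t = C"
    using t nbhd_minus_deficient by blast
  have not: "\<not> t \<subseteq> {g}" "\<not> t \<subseteq> {const (miss g)}" if "g \<in> injections" for g
  proof -
    have "t \<noteq> {}"
      using full colours_empty C_nonempty by auto
    then show "\<not> t \<subseteq> {g}" "\<not> t \<subseteq> {const (miss g)}"
      using full injections_colours[OF that] colours_const by (metis subset_singletonD)+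
  qed
  from s show "t \<in> critical"
  proof (cases rule: critE)
    case (tail g)
    then have "t = s"
      using not[of g] t(2) by auto
    then show ?thesis
      using s by simp
  next
    case (bridge g i)
    then have "t = s"
      using not[of g] not[OF move_injections(1), of g i] t(2) by auto
    then show ?thesis
      using s by simp
  next
    case (triangle g i)
    have "\<not> t \<subseteq> {move g i, const (miss g)}"
    proof
      assume "t \<subseteq> {move g i, const (miss g)}"
      then have "colours {move g i, const (miss g)} = C"
        using full colours_between injections_colourings[OF move_injections(1)] const_colourings injections_image(1) triangle
        by (metis empty_subsetI insert_subset)
      then show False
        using injections_colours_const triangle by blast
    qed
    then have "g \<in> t"
      using t(2) triangle by auto
    then have "t = {g, const (miss g)} \<or> t = {g, move g i} \<or> t = s"
      using not(1)[of g] t(2) triangle by auto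
    then show ?thesis
      using critI triangle s by auto
  qed
qed

text \<open>Without its constant map a tail is a single injection, which misses a colour, and a
  triangle is a bridge. So adding a constant map to a noncritical relative cell never makes it
  critical.\<close>

lemma insert_const_critical:
  assumes "insert (const c) s \<in> critical" "const c \<notin> s" "colours s = C"
  shows "s \<in> critical"
  using assms(1)
proof (cases rule: critE)
  case (tail g)
  then have "const c = const (miss g)"
    using const_notin_injections by (metis insertE insertI1 singletonD)
  then have "insert (const c) s = insert (const c) {g}" "const c \<notin> {g}"
    using tail const_notin_injections[of c] by auto
  then have "s = {g}"
    using insert_ident[OF assms(2)] by metis
  then show ?thesis
    using injections_colours tail assms(3) by blast
next
  case (bridge g i)
  then have "const c \<in> injections"
    using move_injections(1) by (metis insertE insertI1 singletonD)
  then show ?thesis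
    using const_notin_injections by blast
next
  case (triangle g i)
  then have "const c = const (miss g)"
    using const_notin_injections move_injections(1) by (metis insertE insertI1 singletonD)
  then have "insert (const c) s = insert (const c) {g, move g i}" "const c \<notin> {g, move g i}"
    using triangle const_notin_injections[of c] move_injections(1)[of g i] by auto
  then have "s = {g, move g i}"
    using insert_ident[OF assms(2)] by metis
  then show ?thesis
    using critI(2) triangle by blast
qed

text \<open>There are two indices, and the injection \<open>g\<close> cannot have the value
  \<open>c\<close> at both.\<close>

lemma const_mem_nbrs:
  assumes "g \<in> injections" "const c \<in> nbrs g"
  shows "c = miss g"
proof -
  have "c = g i \<or> c = miss g" if "i \<in> I" for i
    using assms(2) that by (auto simp: nbrs_def const_apply)
  then show ?thesis
    using two_indices injections_inj[OF assms(1)] by metis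
qed

text \<open>Adding the constant is settled by \<open>insert_const_critical\<close>. On removal,
  losing the colour \<open>miss g\<close> would force \<open>s\<close> to be a tail or a lone
  constant map, and reaching a critical cell would force \<open>s\<close> to be a triangle.\<close>

lemma toggle_not_critical:
  assumes g: "g \<in> injections" and s: "s \<subseteq> nbrs g" "colours s = C" "s \<notin> critical"
  shows "toggle (const (miss g)) s \<subseteq> nbrs g \<and> colours (toggle (const (miss g)) s) = C
    \<and> toggle (const (miss g)) s \<notin> critical"
proof (cases "const (miss g) \<in> s")
  case False
  let ?t = "insert (const (miss g)) s"
  have "?t \<subseteq> nbrs g"
    using s nbrs_mem(2)[OF g] by blast
  moreover have "colours ?t = C"
    using colours_between[of s ?t] calculation nbrs_colourings s(2) by blast
  moreover have "?t \<notin> critical"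
    using insert_const_critical False s by blast
  ultimately show ?thesis
    using False by (simp add: toggle_def)
next
  case True
  let ?k = "const (miss g)"
  let ?t = "s - {?k}"
  have s_eq: "s = insert ?k ?t"
    using True by blast
  have colours: "insert (miss g) (colours ?t) = C"
    using s(2) by (subst (asm) s_eq) (simp only: colours_insert const_image insert_is_Un[symmetric])
  have mem: "miss g \<in> colours ?t"
  proof (rule ccontr)
    assume no: "miss g \<notin> colours ?t"
    \<comment> \<open>A neighbour of \<open>g\<close> that avoids \<open>miss g\<close> is
      \<open>g\<close> itself.\<close>
    have "f = g" if f: "f \<in> ?t" for f
    proof (rule colourings_eqI)
      show "f \<in> colourings" "g \<in> colourings"
        using f s(1) nbrs_colourings injections_colourings[OF g] by auto
      fix i assume i: "i \<in> I"
      have "f i \<noteq> miss g"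
        using no f i in_colours by metis
      then show "f i = g i"
        using f s(1) i by (auto simp: nbrs_def)
    qed
    then have "?t \<subseteq> {g}"
      by blast
    then have "s = {?k} \<or> s = {g, ?k}"
      using s_eq by blast
    then show False
      using colours_const s(2,3) critI(1)[OF g] by metis
  qed
  then have full: "colours ?t = C"
    using colours by (simp add: insert_absorb)
  have "?t \<notin> critical"
  proof
    assume "?t \<in> critical"
    then show False
    proof (cases rule: critE)
      case (tail f)
      then have "const (miss f) \<in> nbrs g"
        using s(1) by blast
      then have "miss f = miss g"
        using const_mem_nbrs[OF g] by blast
      then show False
        using tail by auto
    next
      case (triangle f i)
      then have "const (miss f) \<in> nbrs g"
        using s(1) by blast
      then have "miss f = miss g"
        using const_mem_nbrs[OF g] by blast
      then show False
        using triangle by auto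
    next
      case (bridge f i)
      show False
      proof (cases "f = g")
        case True
        then have "s = {g, move g i, ?k}"
          using bridge s_eq by auto
        then show False
          using critI(3)[OF g bridge(2)] s(3) by blast
      next
        case False
        \<comment> \<open>The bridge is named from an end other than \<open>g\<close>; uniqueness
          identifies \<open>g\<close> as the opposite end.\<close>
        have "?t \<subseteq> nbrs f"
          using bridge nbrs_mem by auto
        moreover have "?t \<subseteq> nbrs g"
          using s(1) by blast
        ultimately obtain j where j: "j \<in> I" "f = move g j" "?t = {g, f}"
          using nbrs_unique[OF g bridge(1) False[symmetric] _ _ full] by blast
        then have "s = {g, move g j, ?k}"
          using s_eq by auto
        then show False
          using critI(3)[OF g j(1)] s(3) by blast
      qed
    qed
  qed
  then show ?thesis
    using full s(1) True by (auto simp: toggle_def)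
qed

section \<open>The complex relative to the deficient simplices\<close>

lemma finite_nbhd: "finite nbhd"
  by (rule finite_subset[of _ "Pow colourings"]) (auto simp: nbhd_def finite_colourings)

lemma convex_nbhd: "convex_cells nbhd"
proof -
  have "t \<in> nbhd" if "s \<in> nbhd" "t \<subseteq> s" for s t
    using that unfolding nbhd_def mem_Collect_eq by (meson order_trans subsetD)
  moreover have "finite s" if "s \<in> nbhd" for s
    using that finite_subset[OF _ finite_colourings] by (simp add: nbhd_def)
  ultimately show ?thesis
    using finite_nbhd by (simp add: convex_cells_def)
qed

lemma deficient_subset_nbhd: "deficient \<subseteq> nbhd"
proof
  fix s assume "s \<in> deficient"
  then obtain c where sV: "s \<subseteq> colourings" and c: "c \<in> C" "c \<notin> colours s"
    using colours_subset by (auto simp: deficient_def)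
  have "f i \<noteq> const c j" if "f \<in> s" "i \<in> I" "j \<in> I" for f i j
    using c(2) that in_colours by (metis const_apply)
  then show "s \<in> nbhd"
    unfolding nbhd_def using sV const_colourings[OF c(1)] by blast
qed

lemma deficient_lower: "lower_set deficient nbhd"
  unfolding lower_set_def
proof (intro conjI ballI impI)
  show "deficient \<subseteq> nbhd"
    by (rule deficient_subset_nbhd)
  fix s t assume "s \<in> deficient" "t \<in> nbhd" "t \<subseteq> s"
  then show "t \<in> deficient"
    using colours_between[of t s] unfolding deficient_def by blast
qed

text \<open>The choice by \<open>SOME\<close> is safe: off the critical cells the injection is
  unique by \<open>nbrs_unique\<close>, and one that serves a cell serves its faces, so comparable
  cells share the apex.\<close>

lemma betti_not_critical: "betti (nbhd - deficient - critical) d 0"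
proof (rule betti_toggle[where v = "\<lambda>s. const (miss (SOME g. g \<in> injections \<and> s \<subseteq> nbrs g))"])
  show "convex_cells (nbhd - deficient - critical)"
    by (intro convex_cells_Diff convex_nbhd deficient_lower critical_lower)
  have some: "(SOME g. g \<in> injections \<and> s \<subseteq> nbrs g) = g"
    if s: "s \<in> nbhd - deficient - critical" and g: "g \<in> injections" "s \<subseteq> nbrs g" for s g
  proof (rule some_equality)
    fix h assume h: "h \<in> injections \<and> s \<subseteq> nbrs h"
    show "h = g"
    proof (rule ccontr)
      assume "h \<noteq> g"
      then have ne: "g \<noteq> h"
        by simp
      have hJ: "h \<in> injections" and hP: "s \<subseteq> nbrs h" and full: "colours s = C"
        using h s nbhd_minus_deficient by blast+
      obtain i where "i \<in> I" "h = move g i" "s = {g, h}"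
        by (rule nbrs_unique[OF g(1) hJ ne g(2) hP full])
      then show False
        using critI(2)[OF g(1)] s by blast
    qed
  qed (simp add: g)
  have ex: "\<exists>g. g \<in> injections \<and> s \<subseteq> nbrs g \<and> (SOME g. g \<in> injections \<and> s \<subseteq> nbrs g) = g" if "s \<in> nbhd - deficient - critical" for s
    using that some nbhd_minus_deficient by blast
  show "toggle (const (miss (SOME g. g \<in> injections \<and> s \<subseteq> nbrs g))) s \<in> nbhd - deficient - critical"
    if s: "s \<in> nbhd - deficient - critical" for s
  proof -
    obtain g where g: "g \<in> injections" "s \<subseteq> nbrs g" "(SOME g. g \<in> injections \<and> s \<subseteq> nbrs g) = g"
      using ex[OF s] by blast
    have "colours s = C" "s \<notin> critical"
      using s nbhd_minus_deficient by blast+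
    then show ?thesis
      using toggle_not_critical[OF g(1,2)] nbhd_minus_deficient g(1) unfolding g(3) by blast
  qed
  show "const (miss (SOME g. g \<in> injections \<and> t \<subseteq> nbrs g)) = const (miss (SOME g. g \<in> injections \<and> s \<subseteq> nbrs g))"
    if st: "s \<in> nbhd - deficient - critical" "t \<in> nbhd - deficient - critical" "t \<subseteq> s" for s t
  proof -
    obtain g where g: "g \<in> injections" "s \<subseteq> nbrs g" "(SOME g. g \<in> injections \<and> s \<subseteq> nbrs g) = g"
      using ex[OF st(1)] by blast
    then show ?thesis
      using some[OF st(2) g(1)] st(3) by (metis order_trans)
  qed
qed

section \<open>Homology of the deficient subcomplex\<close>

definition constants :: "('a \<Rightarrow> 'b) set" where "constants = const ` C"

definition proper_constants :: "('a \<Rightarrow> 'b) set set" where "proper_constants = {s. s \<subset> constants}"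

lemma card_constants: "card constants = card C"
  unfolding constants_def by (rule card_image) (simp add: inj_on_def const_eq_iff)

lemma finite_constants: "finite constants"
  by (simp add: constants_def finite_C)

lemma colours_consts: "A \<subseteq> C \<Longrightarrow> colours (const ` A) = A"
  by (auto simp: colours_def const_image)

lemma proper_constants_lower: "lower_set proper_constants deficient"
proof -
  have "s \<in> deficient" if s: "s \<in> proper_constants" for s
  proof -
    obtain A where A: "A \<subseteq> C" "s = const ` A"
      using s unfolding proper_constants_def constants_def by (metis mem_Collect_eq psubset_imp_subset subset_imageE)
    then have "A \<noteq> C"
      using s by (auto simp: proper_constants_def constants_def)
    then have "colours s \<noteq> C"
      using A colours_consts by auto
    moreover have "s \<subseteq> colourings"
      using A const_colourings by auto
    ultimately show ?thesis
      by (simp add: deficient_def)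
  qed
  then show ?thesis
    unfolding lower_set_def proper_constants_def by blast
qed

lemma convex_deficient: "convex_cells deficient"
  using convex_cells_lower_set[OF convex_nbhd deficient_lower] .

lemma convex_proper_constants: "convex_cells proper_constants"
  using convex_cells_lower_set[OF convex_deficient proper_constants_lower] .

lemma deficient_minus_proper_constants: "s \<in> deficient - proper_constants \<longleftrightarrow> s \<in> deficient \<and> s - constants \<noteq> {}"
proof -
  have "s \<noteq> constants" if "s \<in> deficient"
    using that colours_consts[of C] by (auto simp: deficient_def constants_def)
  then show ?thesis
    by (auto simp: proper_constants_def)
qed

text \<open>The rank is the number of nonconstant maps. The apex is the constant map of a colour
  which these already use, so toggling it brings in no new colour and leaves the nonconstant part
  alone.\<close>

lemma betti_deficient_minus_proper_constants: "betti (deficient - proper_constants) d 0"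
proof (rule betti_toggle_ranked[where v = "\<lambda>s. const (SOME c. c \<in> colours (s - constants))"
      and r = "\<lambda>s. card (s - constants)" and N = "card colourings"])
  show "convex_cells (deficient - proper_constants)"
    by (rule convex_cells_Diff[OF convex_deficient proper_constants_lower])
  show "toggle (const (SOME c. c \<in> colours (s - constants))) s \<in> deficient - proper_constants
      \<and> card (toggle (const (SOME c. c \<in> colours (s - constants))) s - constants) = card (s - constants)"
    if s: "s \<in> deficient - proper_constants" for s
  proof -
    define c where "c = (SOME c. c \<in> colours (s - constants))"
    obtain f where "f \<in> s - constants"
      using s deficient_minus_proper_constants by blast
    then have "colours (s - constants) \<noteq> {}"
      using two_indices in_colours by (metis empty_iff)
    then have c: "c \<in> colours (s - constants)"
      unfolding c_def by (rule some_in_eq[THEN iffD2])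
    have sV: "s \<subseteq> colourings" and colours: "colours s \<noteq> C"
      using s by (auto simp: deficient_def)
    then have cC: "c \<in> C"
      using c colours_subset[of "s - constants"] by blast
    then have cK: "const c \<in> constants"
      by (simp add: constants_def)
    let ?t = "toggle (const c) s"
    have diff: "?t - constants = s - constants"
      using cK by (auto simp: toggle_def)
    have "colours ?t \<subseteq> insert c (colours s)"
      using colours_insert[of "const c" s] const_image[of c] colours_mono[of "s - {const c}" s]
      by (auto simp: toggle_def)
    then have "colours ?t \<subseteq> colours s"
      using c colours_mono[of "s - constants" s] by blast
    then have "colours ?t \<noteq> C"
      using colours colours_subset[OF sV] by blast
    moreover have "?t \<subseteq> colourings"
      using sV const_colourings[OF cC] by (auto simp: toggle_def)
    ultimately have "?t \<in> deficient"
      by (simp add: deficient_def)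
    then have "?t \<in> deficient - proper_constants"
      using s diff unfolding deficient_minus_proper_constants by simp
    then show ?thesis
      unfolding c_def[symmetric] diff by simp
  qed
  show "card (t - constants) \<le> card (s - constants) \<and> (card (t - constants) = card (s - constants)
      \<longrightarrow> const (SOME c. c \<in> colours (t - constants)) = const (SOME c. c \<in> colours (s - constants)))"
    if st: "s \<in> deficient - proper_constants" "t \<in> deficient - proper_constants" "t \<subseteq> s" for s t
  proof -
    have fin: "finite (s - constants)"
      using st(1) convex_cellsD(2)[OF convex_deficient] by blast
    have sub: "t - constants \<subseteq> s - constants"
      using st(3) by blast
    have "t - constants = s - constants" if "card (t - constants) = card (s - constants)"
      using card_subset_eq[OF fin sub that] .
    then show ?thesis
      using card_mono[OF fin sub] by auto
  qed
  show "card (s - constants) \<le> card colourings" if "s \<in> deficient - proper_constants" for s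
    using that by (intro card_mono finite_colourings) (auto simp: deficient_def)
qed

text \<open>Without the facet \<open>u\<close> opposite \<open>const c\<close>, the boundary of the
  simplex is a cone with apex \<open>const c\<close>. All homology comes from \<open>u\<close>, a
  cell of size \<open>card I\<close>.\<close>

lemma betti_proper_constants: "betti proper_constants d (if d = card I then 1 else 0)"
proof -
  obtain c where c: "c \<in> C"
    using C_nonempty by blast
  define u where "u = constants - {const c}"
  have cK: "const c \<in> constants"
    using c by (simp add: constants_def)
  have card_u: "card u = card I"
    using cK card_constants card_C finite_constants by (simp add: u_def)
  define L where "L = proper_constants - {u}"
  have uD: "u \<in> proper_constants"
    using cK by (auto simp: u_def proper_constants_def)
  have L: "lower_set L proper_constants"
    unfolding lower_set_def
  proof (intro conjI ballI impI)
    show "L \<subseteq> proper_constants"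
      by (auto simp: L_def)
    fix s t assume "s \<in> L" "t \<in> proper_constants" "t \<subseteq> s"
    moreover have "t \<noteq> u"
    proof
      assume "t = u"
      then have "s = u \<or> s = constants"
        using \<open>s \<in> L\<close> \<open>t \<subseteq> s\<close> by (auto simp: u_def L_def proper_constants_def)
      then show False
        using \<open>s \<in> L\<close> by (auto simp: L_def proper_constants_def)
    qed
    ultimately show "t \<in> L"
      by (simp add: L_def)
  qed
  have "betti L e 0" for e
  proof (rule betti_toggle[where v = "\<lambda>_. const c"])
    show "convex_cells L"
      by (rule convex_cells_lower_set[OF convex_proper_constants L])
    show "toggle (const c) s \<in> L" if "s \<in> L" for s
    proof -
      have s: "s \<subseteq> constants" "s \<noteq> constants" "s \<noteq> u"
        using that by (auto simp: L_def proper_constants_def)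
      show ?thesis
      proof (cases "const c \<in> s")
        case True
        then have "s - {const c} \<noteq> u"
          using s(1,2) by (auto simp: u_def)
        then show ?thesis
          using True s cK by (auto simp: toggle_def L_def proper_constants_def)
      next
        case False
        then have "insert (const c) s \<noteq> constants"
          using s(3) by (auto simp: u_def)
        then show ?thesis
          using False s(1) cK by (auto simp: toggle_def L_def proper_constants_def u_def)
      qed
    qed
  qed simp
  moreover have "proper_constants - L = {u}"
    using uD by (auto simp: L_def)
  ultimately show ?thesis
    using betti_lower_acyclic[OF convex_proper_constants L, of d 0 "if d = card I then 1 else 0"]
      betti_singleton[of u d] by (simp add: card_u)
qed

lemma betti_deficient: "betti deficient d (if d = card I then 1 else 0)"
proof -
  have "betti deficient d ((if d = card I then 1 else 0) + 0)"
    by (rule betti_lower_acyclic[OF convex_deficient proper_constants_lower _ betti_proper_constants betti_deficient_minus_proper_constants])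
      (simp add: betti_deficient_minus_proper_constants)
  then show ?thesis
    by simp
qed

lemma betti_nbhd_minus_deficient:
  assumes "betti critical d m"
  shows "betti (nbhd - deficient) d m"
proof -
  have "betti (nbhd - deficient) d (m + 0)"
    by (rule betti_lower_acyclic[OF convex_cells_Diff[OF convex_nbhd deficient_lower] critical_lower _ assms
          betti_not_critical]) (simp add: betti_not_critical)
  then show ?thesis
    by simp
qed

section \<open>Counting critical cells\<close>

lemma finite_injections: "finite injections"
  using finite_colourings by (simp add: injections_def)

lemma card_injections: "card injections = fact (Suc (card I))"
proof -
  have "card injections = card C ^ 0 * prod ((-) (card C)) {0..<card I}"
    using card_inj_on_subset_funcset[OF finite_I finite_C order_refl] by (simp add: injections_def colourings_def)
  \<comment> \<open>The product has \<open>card I\<close> factors, the last being 2; the factor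
    added here is 1.\<close>
  also have "\<dots> = prod (\<lambda>i. Suc (card I) - i) {0..<Suc (card I)}"
    by (simp add: card_C)
  also have "\<dots> = fact (Suc (card I))"
    unfolding fact_prod_rev by simp
  finally show ?thesis .
qed

lemma injections_nonempty: "injections \<noteq> {}"
  using card_injections by (metis card.empty fact_nonzero)

lemma move_inj: "g \<in> injections \<Longrightarrow> i \<in> I \<Longrightarrow> j \<in> I \<Longrightarrow> move g i = move g j \<longleftrightarrow> i = j"
  using injections_miss[of g i] by (metis fun_upd_apply move_def)

lemma card_tail: "g \<in> injections \<Longrightarrow> card {g, const (miss g)} = 2"
  using const_notin_injections by (metis card_2_iff)

lemma card_bridge: "g \<in> injections \<Longrightarrow> i \<in> I \<Longrightarrow> card {g, move g i} = 2"
  using move_injections(4) by (metis card_2_iff)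

lemma card_triangle: "g \<in> injections \<Longrightarrow> i \<in> I \<Longrightarrow> card {g, move g i, const (miss g)} = 3"
  using move_injections(1,4) const_notin_injections by (metis card_3_iff)

lemma card_critical:
  "s \<in> tails \<Longrightarrow> card s = 2" "s \<in> bridges \<Longrightarrow> card s = 2" "s \<in> triangles \<Longrightarrow> card s = 3"
  unfolding tails_def bridges_def triangles_def
  using card_tail card_bridge card_triangle by auto

lemma critical_cells:
  "{s \<in> critical. card s = 2} = tails \<union> bridges"
  "{s \<in> critical. card s = 3} = triangles"
  "d \<noteq> 2 \<Longrightarrow> d \<noteq> 3 \<Longrightarrow> {s \<in> critical. card s = d} = {}"
  using card_critical unfolding critical_def by fastforce+

lemma tail_inj:
  assumes "g \<in> injections" "h \<in> injections" "g \<in> {h, const c}"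
  shows "g = h"
  using assms const_notin_injections by (metis insertE singletonD)

lemma card_tails: "card tails = card injections"
proof -
  have "inj_on (\<lambda>g. {g, const (miss g)}) injections"
    by (rule inj_onI) (metis insertI1 tail_inj)
  then show ?thesis
    by (simp add: tails_def card_image)
qed

lemma triangle_inj:
  assumes "g \<in> injections" "h \<in> injections" "i \<in> I" "j \<in> I"
    and eq: "{g, move g i, const (miss g)} = {h, move h j, const (miss h)}"
  shows "g = h \<and> i = j"
proof -
  have "const (miss g) \<in> {h, move h j, const (miss h)}"
    using eq by blast
  then have miss: "miss g = miss h"
    using const_notin_injections move_injections(1)[OF assms(2,4)] assms(2) const_eq_iff
    by (metis insertE singletonD)
  have "g \<in> {h, move h j, const (miss h)}"
    using eq by blast
  then have "g = h \<or> g = move h j"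
    using const_notin_injections assms(1) by (metis insertE singletonD)
  then have gh: "g = h"
    using miss move_injections(2)[OF assms(2,4)] injections_miss[OF assms(2,4)] by auto
  have "move g i \<in> {h, move h j, const (miss h)}"
    using eq by blast
  then have "move g i = move g j"
    using gh const_notin_injections move_injections(1,4)[OF assms(1,3)] by (metis insertE singletonD)
  then show ?thesis
    using gh move_inj assms by blast
qed

lemma card_triangles: "card triangles = card injections * card I"
proof -
  have "inj_on (\<lambda>(g, i). {g, move g i, const (miss g)}) (injections \<times> I)"
    by (rule inj_onI) (use triangle_inj in \<open>auto split: prod.splits\<close>)
  then show ?thesis
    by (simp add: triangles_def card_image card_cartesian_product)
qed

text \<open>A second move at the same index undoes the first, so a bridge arises from exactly two
  pairs, one for each end.\<close>

lemma bridge_fiber: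
  assumes "g \<in> injections" "i \<in> I"
  shows "{x \<in> injections \<times> I. (case x of (h, j) \<Rightarrow> {h, move h j}) = {g, move g i}}
    = {(g, i), (move g i, i)}"
proof -
  have "h = g \<and> j = i \<or> h = move g i \<and> j = i"
    if h: "h \<in> injections" "j \<in> I" "{h, move h j} = {g, move g i}" for h j
  proof -
    have "h = g \<and> move h j = move g i \<or> h = move g i \<and> move h j = g"
      using h(3) by (auto simp: doubleton_eq_iff)
    then show ?thesis
      using move_inj[OF h(1,2) assms(2)] move_injections(3)[OF assms] by metis
  qed
  moreover have "{move g i, move (move g i) i} = {g, move g i}"
    using move_injections(3)[OF assms] by auto
  ultimately show ?thesis
    using assms move_injections(1)[OF assms] by auto
qed

lemma card_bridges: "2 * card bridges = card injections * card I"
proof -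
  let ?f = "\<lambda>(g, i). {g, move g i}"
  have "card (injections \<times> I) = (\<Sum>b\<in>?f ` (injections \<times> I). card {x \<in> injections \<times> I. ?f x = b})"
    using sum.image_gen[of "injections \<times> I" "\<lambda>_. 1 :: nat" ?f] finite_injections finite_I by simp
  also have "\<dots> = (\<Sum>b\<in>?f ` (injections \<times> I). 2)"
  proof (rule sum.cong[OF refl])
    fix b assume "b \<in> ?f ` (injections \<times> I)"
    then obtain g i where g: "g \<in> injections" "i \<in> I" "b = {g, move g i}"
      by auto
    show "card {x \<in> injections \<times> I. ?f x = b} = 2"
      unfolding g(3) bridge_fiber[OF g(1,2)] using move_injections(4)[OF g(1,2)] by (simp add: eq_commute)
  qed
  finally show ?thesis
    by (simp add: bridges_def card_cartesian_product)
qed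

lemma tails_Int_bridges: "tails \<inter> bridges = {}"
proof -
  have False if "g \<in> injections" "h \<in> injections" "i \<in> I" "{g, const (miss g)} = {h, move h i}" for g h i
  proof -
    have "const (miss g) \<in> {h, move h i}"
      using that(4) by blast
    then show False
      using const_notin_injections move_injections(1)[OF that(2,3)] that(2) by (metis insertE singletonD)
  qed
  then show ?thesis
    unfolding tails_def bridges_def by auto
qed

lemma finite_critical: "finite critical"
  using finite_subset[OF critical_subset] finite_nbhd by simp

lemma card_critical_2: "card {s \<in> critical. card s = 2} = card tails + card bridges"
  unfolding critical_cells(1) using finite_critical tails_Int_bridges
  by (intro card_Un_disjoint) (simp_all add: critical_def)

section \<open>The incidence graph of the critical cells\<close>

lemma faces_triangle:
  assumes "g \<in> injections" "i \<in> I"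
  shows "s \<in> critical \<and> card s = 2 \<and> s \<subset> {g, move g i, const (miss g)}
    \<longleftrightarrow> s = {g, const (miss g)} \<or> s = {g, move g i}"
proof
  assume s: "s \<in> critical \<and> card s = 2 \<and> s \<subset> {g, move g i, const (miss g)}"
  then have "colours s = C"
    using critical_subset nbhd_minus_deficient by blast
  then have "s \<noteq> {move g i, const (miss g)}"
    using injections_colours_const[OF assms] by blast
  moreover obtain a b where "s = {a, b}" "a \<noteq> b"
    using s by (metis card_2_iff)
  ultimately show "s = {g, const (miss g)} \<or> s = {g, move g i}"
    using s by auto
next
  assume s: "s = {g, const (miss g)} \<or> s = {g, move g i}"
  then have "s \<in> critical" "card s = 2"
    using critI(1)[OF assms(1)] critI(2)[OF assms] card_tail[OF assms(1)] card_bridge[OF assms]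
    by auto
  moreover have "s \<subseteq> {g, move g i, const (miss g)}"
    using s by blast
  moreover have "s \<noteq> {g, move g i, const (miss g)}"
    using card_triangle[OF assms] \<open>card s = 2\<close> by auto
  ultimately show "s \<in> critical \<and> card s = 2 \<and> s \<subset> {g, move g i, const (miss g)}"
    by blast
qed

lemma tail_neq_bridge: "g \<in> injections \<Longrightarrow> i \<in> I \<Longrightarrow> {g, const (miss g)} \<noteq> {g, move g i}"
  using const_notin_injections move_injections(1) by (metis doubleton_eq_iff)

lemma bd_triangle:
  assumes "g \<in> injections" "i \<in> I"
  shows "bd critical (ind {{g, move g i, const (miss g)}})
    = ind {{g, const (miss g)}} + ind {{g, move g i}}"
proof
  fix s
  let ?t = "{g, move g i, const (miss g)}"
  have t: "?t \<in> critical" "card ?t = 3"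
    using critI(3)[OF assms] card_triangle[OF assms] .
  have iff: "s \<in> critical \<and> ?t \<in> cofaces critical s \<longleftrightarrow> s = {g, const (miss g)} \<or> s = {g, move g i}"
    using faces_triangle[OF assms, of s] t by (auto simp: cofaces_def)
  have "bd critical (ind {?t}) s = (if s \<in> critical \<and> ?t \<in> cofaces critical s then 1 else 0)"
    using finite_cofaces[OF finite_critical, of s] by (simp add: bd_def ind_def sum.delta)
  also have "\<dots> = (ind {{g, const (miss g)}} + ind {{g, move g i}}) s"
    unfolding iff using tail_neq_bridge[OF assms] by (auto simp: ind_def)
  finally show "bd critical (ind {?t}) s = (ind {{g, const (miss g)}} + ind {{g, move g i}}) s" .
qed

lemma tail_bridge_homologous:
  assumes "g \<in> injections" "i \<in> I"
  shows "ind {{g, const (miss g)}} + ind {{g, move g i}} \<in> boundaries critical 2"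
proof -
  have "ind {{g, move g i, const (miss g)}} \<in> cell_chains critical (Suc 2)"
    using critI(3)[OF assms] card_triangle[OF assms] by (intro ind_in_cell_chains) simp
  then show ?thesis
    unfolding boundaries_def bd_triangle[OF assms, symmetric] by (rule imageI)
qed

text \<open>The two triangles over the bridge \<open>{g, move g i}\<close> connect the tails of its
  ends: the incidence graph is the graph of moves between injections with every edge subdivided by
  its bridge.\<close>

lemma tail_move_homologous:
  assumes "g \<in> injections" "i \<in> I"
  shows "ind {{g, const (miss g)}} + ind {{move g i, const (miss (move g i))}} \<in> boundaries critical 2"
proof (rule homologous_trans[OF tail_bridge_homologous[OF assms]])
  show "ind {{g, move g i}} + ind {{move g i, const (miss (move g i))}} \<in> boundaries critical 2"
    using tail_bridge_homologous[OF move_injections(1)[OF assms] assms(2)] move_injections(3)[OF assms]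
    by (simp add: add.commute insert_commute)
qed

text \<open>
  Moves act on injections like a sliding puzzle whose blank is the missing colour; the measure
  counts misplaced entries twice and the blank being home once, since a correctly placed blank
  has to be moved away before a misplaced entry can be repaired.
\<close>
lemma tails_homologous:
  assumes "g \<in> injections" "h \<in> injections"
  shows "ind {{g, const (miss g)}} + ind {{h, const (miss h)}} \<in> boundaries critical 2"
  using assms(1)
proof (induction "2 * card {i \<in> I. g i \<noteq> h i} + (if miss g = miss h then 1 else 0)"
    arbitrary: g rule: less_induct)
  case less
  let ?m = "\<lambda>g. 2 * card {i \<in> I. g i \<noteq> h i} + (if miss g = miss h then 1 else 0 :: nat)"
  show ?case
  proof (cases "g = h")
    case True
    then show ?thesis
      by (simp add: zero_in_boundaries)
  next
    case False
    have "\<exists>i\<in>I. ?m (move g i) < ?m g"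
    proof (cases "miss g = miss h")
      case True
      obtain i where i: "i \<in> I" "g i \<noteq> h i"
        using colourings_eqI[OF injections_colourings[OF less.prems] injections_colourings[OF assms(2)]] False by blast
      \<comment> \<open>Entry \<open>i\<close> stays misplaced: it now holds \<open>miss h\<close>,
        which \<open>h\<close> does not use.\<close>
      have "{k \<in> I. move g i k \<noteq> h k} = {k \<in> I. g k \<noteq> h k}"
        using i True injections_miss[OF assms(2) i(1)] by (auto simp: move_def)
      moreover have "miss (move g i) \<noteq> miss h"
        using move_injections(2)[OF less.prems i(1)] injections_miss[OF less.prems i(1)] True by simp
      ultimately have "?m (move g i) < ?m g"
        using True by simp
      then show ?thesis
        using i(1) by blast
    next
      case False
      \<comment> \<open>\<open>h\<close> wants the missing colour of \<open>g\<close> at this index.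
        The move repairs the entry, which outweighs the blank possibly coming home.\<close>
      then obtain i where i: "i \<in> I" "h i = miss g"
        using injections_image(1)[OF less.prems] injections_image(3)[OF assms(2)] by auto
      have eq: "{k \<in> I. move g i k \<noteq> h k} = {k \<in> I. g k \<noteq> h k} - {i}"
        using i by (auto simp: move_def)
      have "i \<in> {k \<in> I. g k \<noteq> h k}"
        using i injections_miss[OF less.prems i(1)] by simp
      then have "card {k \<in> I. move g i k \<noteq> h k} < card {k \<in> I. g k \<noteq> h k}"
        unfolding eq using finite_I by (intro card_Diff1_less) auto
      then have "?m (move g i) < ?m g"
        using False by simp
      then show ?thesis
        using i(1) by blast
    qed
    then obtain i where i: "i \<in> I" "?m (move g i) < ?m g"
      by blast
    show ?thesis
      using homologous_trans[OF tail_move_homologous[OF less.prems i(1)]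
          less.hyps[OF i(2) move_injections(1)[OF less.prems i(1)]]] .
  qed
qed

lemma critical_homologous:
  assumes "s \<in> critical" "card s = 2" "h \<in> injections"
  shows "ind {s} + ind {{h, const (miss h)}} \<in> boundaries critical 2"
proof -
  have "s \<in> tails \<union> bridges"
    using assms critical_cells(1) by blast
  then consider g where "g \<in> injections" "s = {g, const (miss g)}"
    | g i where "g \<in> injections" "i \<in> I" "s = {g, move g i}"
    unfolding tails_def bridges_def by auto
  then show ?thesis
  proof cases
    case 1
    then show ?thesis
      using tails_homologous assms(3) by simp
  next
    case 2
    then have "ind {s} + ind {{g, const (miss g)}} \<in> boundaries critical 2"
      using tail_bridge_homologous[OF 2(1,2)] by (simp add: add.commute)
    then show ?thesis
      using homologous_trans tails_homologous[OF 2(1) assms(3)] by blast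
  qed
qed

lemma card_chains_critical_2: "card (cell_chains critical 2) = 2 * card (boundaries critical 2)"
proof -
  obtain h where h: "h \<in> injections"
    using injections_nonempty by blast
  show ?thesis
  proof (rule betti_connected[OF finite_critical critI(1)[OF h] card_tail[OF h]])
    show "ind {s} + ind {{h, const (miss h)}} \<in> boundaries critical 2" if "s \<in> critical" "card s = 2" for s
      using critical_homologous[OF that h] .
    fix t assume "t \<in> critical" "card t = Suc 2"
    then have "t \<in> triangles"
      using critical_cells(2) by auto
    then obtain g i where g: "g \<in> injections" "i \<in> I" "t = {g, move g i, const (miss g)}"
      by (auto simp: triangles_def)
    have "{s \<in> critical. card s = 2 \<and> s \<subset> t} = {{g, const (miss g)}, {g, move g i}}"
      using faces_triangle[OF g(1,2)] unfolding g(3) by blast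
    then show "even (card {s \<in> critical. card s = 2 \<and> s \<subset> t})"
      using tail_neq_bridge[OF g(1,2)] by simp
  qed
qed

lemma betti_critical_2: "betti critical 2 1"
proof -
  have "bd critical c = 0" if "c \<in> cell_chains critical 2" for c
    using bd_in_cell_chains[of c critical 1] that cell_chains_empty[OF critical_cells(3), of 1]
    by (simp add: numeral_2_eq_2)
  then have "cycles critical 2 = cell_chains critical 2"
    by (auto simp: cycles_def)
  then show ?thesis
    by (simp add: betti_def card_chains_critical_2)
qed

text \<open>The cycle rank of a connected graph with tails and bridges as vertices and triangles as
  edges: edges minus vertices plus one. There are no larger cells, hence no boundaries to divide
  out.\<close>

lemma betti_critical_3:
  assumes "q + card tails + card bridges = Suc (card triangles)"
  shows "betti critical 3 q"
proof -
  have "2 ^ card triangles = card (cycles critical 3) * card (boundaries critical 2)"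
    using card_cycles_times_boundaries[OF finite_critical, of 2] card_cell_chains(2)[OF finite_critical, of 3]
    by (simp add: critical_cells(2))
  moreover have "2 ^ (card tails + card bridges) = 2 * card (boundaries critical 2)"
    using card_chains_critical_2 card_cell_chains(2)[OF finite_critical, of 2] by (simp add: card_critical_2)
  ultimately have "card (cycles critical 3) * 2 ^ (card tails + card bridges) = 2 ^ Suc (card triangles)"
    by simp
  also have "\<dots> = 2 ^ q * 2 ^ (card tails + card bridges)"
    unfolding assms[symmetric] by (simp add: power_add)
  finally have "card (cycles critical 3) = 2 ^ q"
    by simp
  moreover have "boundaries critical 3 = {0}"
    by (rule boundaries_empty) (simp add: critical_cells(3))
  ultimately show ?thesis
    by (simp add: betti_def)
qed

section \<open>Betti numbers of the neighborhood complex\<close>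

lemma rank_eq:
  assumes "p = (fact (card I) * (card I - 1) * card I) div 2"
  shows "(p - fact (card I) + 1) + card tails + card bridges = Suc (card triangles)"
proof -
  define F where "F = (fact (card I) :: nat)"
  obtain k where k: "card I = Suc k" "k > 0"
    using card_I by (cases "card I") auto
  have "even (k * Suc k)"
    by simp
  \<comment> \<open>\<open>e\<close> is the binomial coefficient of \<open>card I\<close> over 2, so
    that \<open>p = F * e\<close>.\<close>
  then obtain e where e: "k * Suc k = 2 * e"
    by (rule evenE)
  have "e > 0"
    using e k(2) by (metis gr0I mult_eq_0_iff nat.distinct(1) neq0_conv)
  have "p = (2 * (F * e)) div 2"
    unfolding assms F_def[symmetric] using k e by (simp add: algebra_simps)
  then have p: "p = F * e"
    by simp
  have injections: "card injections = (k + 2) * F"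
    by (simp add: card_injections F_def k)
  have "(k + 2) * Suc k = 2 * (e + Suc k)"
    using e by (simp add: algebra_simps)
  moreover have "2 * card bridges = ((k + 2) * Suc k) * F"
    by (simp add: card_bridges injections k algebra_simps)
  ultimately have "2 * card bridges = 2 * ((e + Suc k) * F)"
    by simp
  then have b: "card bridges = (e + Suc k) * F"
    by simp
  have "card triangles = 2 * card bridges"
    using card_bridges card_triangles by simp
  \<comment> \<open>Subtraction on naturals is truncated; \<open>p = F + r\<close> makes
    \<open>p - F\<close> exact.\<close>
  moreover have "F \<le> p"
    using \<open>e > 0\<close> p by simp
  then obtain r where "p = F + r"
    by (rule less_eqE)
  moreover have "F * e = F + r"
    using p calculation(2) by simp
  ultimately show ?thesis
    using b injections by (simp add: card_tails F_def[symmetric] algebra_simps)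
qed

lemma betti_critical:
  assumes "p = (fact (card I) * (card I - 1) * card I) div 2"
  shows "betti critical d (if d = 2 then 1 else if d = 3 then p - fact (card I) + 1 else 0)"
  using betti_critical_2 betti_critical_3[OF rank_eq[OF assms]] betti_empty[OF critical_cells(3), of d] by auto

text \<open>\<open>deficient\<close> has homology only at size \<open>card I\<close>, the relative
  complex only at sizes 2 and 3. A connecting homomorphism into size \<open>card I\<close> would
  start at size \<open>card I + 1\<close>, which exceeds 3.\<close>

lemma betti_nbhd:
  assumes "p = (fact (card I) * (card I - 1) * card I) div 2" "3 \<le> card I"
  shows "betti nbhd d ((if d = card I then 1 else 0)
    + (if d = 2 then 1 else if d = 3 then p - fact (card I) + 1 else 0))"
proof (rule betti_lower[OF convex_nbhd deficient_lower _ betti_deficient betti_nbhd_minus_deficient[OF betti_critical[OF assms(1)]]])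
  fix d
  show "cycles (nbhd - deficient) (Suc d) = boundaries (nbhd - deficient) (Suc d) \<or> cycles deficient d = boundaries deficient d"
  proof (cases "d = card I")
    case True
    then have "betti (nbhd - deficient) (Suc d) 0"
      using betti_nbhd_minus_deficient[OF betti_critical[OF assms(1)], of "Suc d"] assms(2) by simp
    then show ?thesis
      using betti_0_iff[OF convex_cells_Diff[OF convex_nbhd deficient_lower]] by blast
  next
    case False
    then have "betti deficient d 0"
      using betti_deficient[of d] by simp
    then show ?thesis
      using betti_0_iff[OF convex_deficient] by blast
  qed
qed

text \<open>The bound on \<open>card I\<close> separates the sphere class from the triangles, which
  have size 3. The class at size 1 comes from dropping the empty cell.\<close>

lemma betti_nonempty_simplices:
  assumes "p = (fact (card I) * (card I - 1) * card I) div 2" "4 \<le> card I"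
  shows "betti (nbhd - {{}}) (Suc d) ((if Suc d = card I \<or> Suc d = 1 \<or> Suc d = 2 then 1 else 0)
    + (if Suc d = 3 then p - fact (card I) + 1 else 0))"
proof (cases d)
  case 0
  obtain c where "c \<in> C"
    using C_nonempty by blast
  then have "{} \<in> deficient" "{const c} \<in> deficient"
    using C_nonempty by (simp_all add: deficient_def colours_empty const_colourings colours_const C_nonempty[symmetric])
  then have "{} \<in> nbhd" "{const c} \<in> nbhd"
    using deficient_subset_nbhd by (simp_all add: subsetD)
  moreover have "betti nbhd 1 0"
    using betti_nbhd[OF assms(1), of 1] assms(2) by simp
  ultimately have "betti (nbhd - {{}}) 1 (Suc 0)"
    using betti_Diff_empty_1[OF convex_nbhd] by blast
  then show ?thesis
    using 0 assms(2) by simp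
next
  case (Suc e)
  have "(if Suc (Suc e) = card I then 1 else 0) + (if Suc (Suc e) = 2 then 1
      else if Suc (Suc e) = 3 then p - fact (card I) + 1 else 0)
    = (if Suc d = card I \<or> Suc d = 1 \<or> Suc d = 2 then 1 else 0)
      + (if Suc d = 3 then p - fact (card I) + 1 else 0)"
    using assms(2) Suc by auto
  moreover have "3 \<le> card I"
    using assms(2) by simp
  ultimately show ?thesis
    using betti_Diff_empty[OF betti_nbhd[OF assms(1), of "Suc (Suc e)"]] unfolding Suc by metis
qed

lemma homology_nbhd:
  fixes k :: int
  assumes p: "p = (fact (card I) * (card I - 1) * card I) div 2" and card: "4 \<le> card I"
  defines "H \<equiv> simplicial_homology k (nbhd - {{}})"
  shows "(k \<in> {0, 1, int (card I) - 1} \<longrightarrow> H \<cong> Z2) \<and>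
         (k = 2 \<longrightarrow> H \<cong> Z2_power (p - fact (card I) + 1)) \<and>
         (k \<notin> {0, 1, 2, int (card I) - 1} \<longrightarrow> trivial_group H)"
proof (cases "k < 0")
  case True
  then show ?thesis
    using simplicial_homology_neg[OF True, of "nbhd - {{}}"] card by (simp add: H_def)
next
  case False
  then obtain d where d: "k = int d"
    by (metis nat_0_le not_less)
  have "{} \<in> nbhd"
    using deficient_subset_nbhd colours_empty C_nonempty by (auto simp: deficient_def)
  then have "lower_set {{}} nbhd"
    by (auto simp: lower_set_def)
  then have X: "convex_cells (nbhd - {{}})" "{} \<notin> nbhd - {{}}"
    using convex_cells_Diff[OF convex_nbhd] by simp_all
  note betti = betti_nonempty_simplices[OF p card, of d]
  consider "d = 2" | "d = 0 \<or> d = 1 \<or> d = card I - 1" "d \<noteq> 2"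
    | "d \<noteq> 0" "d \<noteq> 1" "d \<noteq> 2" "d \<noteq> card I - 1"
    by blast
  then show ?thesis
  proof cases
    case 1
    then have "betti (nbhd - {{}}) (Suc d) (p - fact (card I) + 1)"
      using betti card by simp
    then have "H \<cong> Z2_power (p - fact (card I) + 1)"
      unfolding H_def d by (rule simplicial_homology_iso(2)[OF X])
    then show ?thesis
      using 1 d card by simp
  next
    case 2
    then have "betti (nbhd - {{}}) (Suc d) 1"
      using betti card by auto
    then have "H \<cong> Z2_power 1"
      unfolding H_def d by (rule simplicial_homology_iso(2)[OF X])
    then have "H \<cong> Z2"
      using iso_trans group.iso_sym[OF group_integer_mod_group Z2_iso_Z2_power] by blast
    then show ?thesis
      using 2 d card by auto
  next
    case 3
    then have "Suc d \<noteq> card I"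
      by linarith
    then have "betti (nbhd - {{}}) (Suc d) 0"
      using betti 3 by simp
    then have "trivial_group H"
      unfolding H_def d by (rule simplicial_homology_trivial[OF X])
    then show ?thesis
      using 3 d card by auto
  qed
qed

end

section \<open>The graphs of the theorem\<close>

lemma verts_complete_graph: "verts (complete_graph n) = {1..n}"
  by (simp add: complete_graph_def)

lemma edges_complete_graph:
  "(i, j) \<in> edges (complete_graph n) \<longleftrightarrow> i \<in> {1..n} \<and> j \<in> {1..n} \<and> i \<noteq> j"
  by (simp add: complete_graph_def)

lemma neighborhood_complex_exponential:
  assumes "2 \<le> n" and I: "I = {1..n}" and C: "C = {1..n + 1}"
  shows "exponential_complete I C"
    and "neighborhood_complex (exponential_graph (complete_graph n) (complete_graph (n + 1)))
      = exponential_complete.nbhd I C - {{}}"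
proof -
  show complete: "exponential_complete I C"
    by unfold_locales (use assms in simp_all)
  interpret exponential_complete I C
    by (rule complete)
  let ?G = "exponential_graph (complete_graph n) (complete_graph (n + 1))"
  have verts: "verts ?G = colourings"
    unfolding exponential_graph_def verts_complete_graph colourings_def I[symmetric] C[symmetric] fst_conv
    by (rule refl)
  \<comment> \<open>The values of colourings are vertices of the target anyway, so adjacency there
    reduces to inequality.\<close>
  have adj: "(f, g) \<in> edges ?G \<longleftrightarrow> (\<forall>i\<in>I. \<forall>j\<in>I. i \<noteq> j \<longrightarrow> f i \<noteq> g j)"
    if "f \<in> colourings" "g \<in> colourings" for f g
  proof -
    have "(f, g) \<in> edges ?G \<longleftrightarrow> (\<forall>i\<in>I. \<forall>j\<in>I. i \<noteq> j \<longrightarrow> f i \<in> C \<and> g j \<in> C \<and> f i \<noteq> g j)"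
      using that
      unfolding exponential_graph_def colourings_def verts_complete_graph edges_complete_graph
        I[symmetric] C[symmetric]
      by simp
    then show ?thesis
      using colourings_apply[OF that(1)] colourings_apply[OF that(2)] by blast
  qed
  have "s \<in> neighborhood_complex ?G \<longleftrightarrow> s \<in> nbhd \<and> s \<noteq> {}" for s
  proof (cases "s \<subseteq> colourings")
    case True
    have "finite s"
      by (rule finite_subset[OF True finite_colourings])
    moreover have "(\<exists>g\<in>colourings. \<forall>f\<in>s. (f, g) \<in> edges ?G)
        \<longleftrightarrow> (\<exists>g\<in>colourings. \<forall>f\<in>s. \<forall>i\<in>I. \<forall>j\<in>I. i \<noteq> j \<longrightarrow> f i \<noteq> g j)"
      using adj True by (intro bex_cong ball_cong refl) blast
    ultimately show ?thesis
      using True unfolding neighborhood_complex_def verts nbhd_def mem_Collect_eq by blast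
  next
    case False
    then show ?thesis
      unfolding neighborhood_complex_def verts nbhd_def by simp
  qed
  then show "neighborhood_complex ?G = nbhd - {{}}"
    by blast
qed

theorem theorem1p1:
  fixes n p :: nat and k :: int
  assumes "n \<ge> 4"
    and "p = (fact n * (n - 1) * n) div 2"
  defines "H \<equiv> simplicial_homology k
    (neighborhood_complex (exponential_graph (complete_graph n) (complete_graph (n + 1))))"
  shows "(k \<in> {0, 1, int n - 1} \<longrightarrow> H \<cong> Z2) \<and>
         (k = 2 \<longrightarrow> H \<cong> Z2_power (p - fact n + 1)) \<and>
         (k \<notin> {0, 1, 2, int n - 1} \<longrightarrow> trivial_group H)"
proof -
  have n: "2 \<le> n"
    using assms(1) by simp
  have card: "card {1..n} = n"
    by simp
  show ?thesis
    unfolding H_def neighborhood_complex_exponential(2)[OF n refl refl]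
    using exponential_complete.homology_nbhd[OF neighborhood_complex_exponential(1)[OF n refl refl],
        unfolded card, OF assms(2,1)] .
qed

end
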